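(* Let $\mathbb F$ be an algebraically closed field, $\mathrm{char}\,\mathbb F\ne2$. Let $n\ge5$ be odd, and let $q,s\ge0$ be integers with $q+2s=n$. Consider the fine grading $\Gamma=\Gamma_B(q,s)$ on $\mathfrak{so}_n(\mathbb F)$ defined in the context. Then its Weyl group is $$W(\Gamma)\cong\mathrm{Sym}(q)\times W(s),$$ where $W(s)=\mathbb Z_2^s\rtimes\mathrm{Sym}(s)$ (the wreath product of $\mathrm{Sym}(s)$ and $\mathbb Z_2$).
   Context: Gradings. All grading groups are abelian. For a grading $\Gamma$ on an algebra $\mathcal A$, $\mathrm{Aut}(\Gamma)$ is the group of automorphisms of $\mathcal A$ that permute the components of $\Gamma$, $\mathrm{Stab}(\Gamma)$ is the subgroup of automorphisms mapping each component to itself, and the Weyl group is $W(\Gamma)=\mathrm{Aut}(\Gamma)/\mathrm{Stab}(\Gamma)$. A grading is fine if it admits no proper refinement among gradings by abelian groups. The grading $\Gamma_B(q,s)$. Let $\widetilde G$ be the abelian group generated by symbols $\widetilde g_1,\ldots,\widetilde g_{q+2s}$ with defining relations $$\widetilde g_1^2=\cdots=\widetilde g_q^2=\widetilde g_{q+1}\widetilde g_{q+2}=\cdots=\widetilde g_{q+2s-1}\widetilde g_{q+2s}.$$ Grade $\mathcal R=M_n(\mathbb F)$ by $\deg E_{ij}=\widetilde g_i\widetilde g_j^{-1}$; this is a grading by the subgroup $G\cong\mathbb Z_2^{q-1}\times\mathbb Z^s$ of $\widetilde G$ generated by the support. Let $$\Phi=\mathrm{diag}\left(\underbrace{1,\ldots,1}_q,\begin{bmatrix}0&1\\1&0\end{bmatrix},\ldots,\begin{bmatrix}0&1\\1&0\end{bmatrix}\right)$$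 with $s$ blocks of size $2$, and let $\varphi(X)=\Phi^{-1}({}^tX)\Phi$, an orthogonal involution of $\mathcal R$ preserving each homogeneous component. $\Gamma_B(q,s)$ is the restriction of this grading to the Lie algebra of skew-symmetric elements $\{X\in\mathcal R:\varphi(X)=-X\}\cong\mathfrak{so}_n(\mathbb F)$. *)

theory Defs
  imports
    "HOL-Algebra.Bij"
    "HOL-Algebra.Product_Groups"
    "HOL-Algebra.Free_Abelian_Groups"
    "HOL-Algebra.Sym_Groups"
    "Jordan_Normal_Form.VS_Connect"
    "Jordan_Normal_Form.Gauss_Jordan_Elimination"
begin

text \<open>
  Throughout, a Lie algebra is given by its underlying subspace \<open>L\<close> of square matrices, with
  the commutator as bracket, and a grading on \<open>L\<close> by its set \<open>\<Gamma>\<close> of nonzero homogeneous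
  components.  Maps on \<open>L\<close> are extensional functions, so that \<^term>\<open>BijGroup L\<close> is the group of
  all permutations of \<open>L\<close>.
\<close>

definition lie_bracket :: "'a::field mat \<Rightarrow> 'a mat \<Rightarrow> 'a mat" where
  "lie_bracket X Y = X * Y - Y * X"

definition lie_automorphisms :: "'a::field mat set \<Rightarrow> ('a mat \<Rightarrow> 'a mat) set" where
  "lie_automorphisms L = {f \<in> Bij L.
     (\<forall>X\<in>L. \<forall>Y\<in>L. f (X + Y) = f X + f Y) \<and>
     (\<forall>c. \<forall>X\<in>L. f (c \<cdot>\<^sub>m X) = c \<cdot>\<^sub>m f X) \<and>
     (\<forall>X\<in>L. \<forall>Y\<in>L. f (lie_bracket X Y) = lie_bracket (f X) (f Y))}"

definition grading_aut :: "'a::field mat set \<Rightarrow> 'a mat set set \<Rightarrow> ('a mat \<Rightarrow> 'a mat) set" where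
  "grading_aut L \<Gamma> = {f \<in> lie_automorphisms L. bij_betw (\<lambda>U. f ` U) \<Gamma> \<Gamma>}"

definition grading_stab :: "'a::field mat set \<Rightarrow> 'a mat set set \<Rightarrow> ('a mat \<Rightarrow> 'a mat) set" where
  "grading_stab L \<Gamma> = {f \<in> lie_automorphisms L. \<forall>U\<in>\<Gamma>. f ` U = U}"

definition weyl_group ::
  "'a::field mat set \<Rightarrow> 'a mat set set \<Rightarrow> ('a mat \<Rightarrow> 'a mat) set monoid" where
  "weyl_group L \<Gamma> = (BijGroup L\<lparr>carrier := grading_aut L \<Gamma>\<rparr>) Mod (grading_stab L \<Gamma>)"

text \<open>
  Indices are shifted to start from \<open>0\<close>: the generators are numbered \<open>0, \<dots>, q + 2 * s - 1\<close>, the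
  pairs being \<open>(q + 2 * k, q + 2 * k + 1)\<close> for \<open>k < s\<close>.  The free abelian group of the library is
  additive, so \<^term>\<open>frag_of i + frag_of j\<close> stands for the product of the generators
  \<open>i\<close> and \<open>j\<close>.
\<close>

definition B_words :: "nat \<Rightarrow> nat \<Rightarrow> (nat \<Rightarrow>\<^sub>0 int) set" where
  "B_words q s = {frag_of i + frag_of i | i. i < q} \<union>
     {frag_of (q + 2 * k) + frag_of (q + 2 * k + 1) | k. k < s}"

definition B_relations :: "nat \<Rightarrow> nat \<Rightarrow> (nat \<Rightarrow>\<^sub>0 int) set" where
  "B_relations q s = generate (free_Abelian_group {0..<q + 2 * s})
     {u - v | u v. u \<in> B_words q s \<and> v \<in> B_words q s}"

definition B_big_group :: "nat \<Rightarrow> nat \<Rightarrow> (nat \<Rightarrow>\<^sub>0 int) set monoid" where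
  "B_big_group q s = free_Abelian_group {0..<q + 2 * s} Mod B_relations q s"

definition B_gen :: "nat \<Rightarrow> nat \<Rightarrow> nat \<Rightarrow> (nat \<Rightarrow>\<^sub>0 int) set" where
  "B_gen q s i = B_relations q s #>\<^bsub>free_Abelian_group {0..<q + 2 * s}\<^esub> frag_of i"

definition B_deg :: "nat \<Rightarrow> nat \<Rightarrow> nat \<Rightarrow> nat \<Rightarrow> (nat \<Rightarrow>\<^sub>0 int) set" where
  "B_deg q s i j = B_gen q s i \<otimes>\<^bsub>B_big_group q s\<^esub> inv\<^bsub>B_big_group q s\<^esub> B_gen q s j"

definition B_group :: "nat \<Rightarrow> nat \<Rightarrow> (nat \<Rightarrow>\<^sub>0 int) set set" where
  "B_group q s = generate (B_big_group q s)
     {B_deg q s i j | i j. i < q + 2 * s \<and> j < q + 2 * s}"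

definition matrix_unit :: "nat \<Rightarrow> nat \<Rightarrow> nat \<Rightarrow> 'a::field mat" where
  "matrix_unit n i j = mat n n (\<lambda>(k, l). if k = i \<and> l = j then 1 else 0)"

definition R_component :: "nat \<Rightarrow> nat \<Rightarrow> (nat \<Rightarrow>\<^sub>0 int) set \<Rightarrow> 'a::field mat set" where
  "R_component q s g = LinearCombinations.module.span class_ring
     (module_mat TYPE('a) (q + 2 * s) (q + 2 * s))
     {matrix_unit (q + 2 * s) i j | i j. i < q + 2 * s \<and> j < q + 2 * s \<and> B_deg q s i j = g}"

definition B_form :: "nat \<Rightarrow> nat \<Rightarrow> 'a::field mat" where
  "B_form q s = diag_block_mat (1\<^sub>m q # replicate s (mat_of_rows_list 2 [[0, 1], [1, 0]]))"

text \<open>\<^const>\<open>mat_inverse\<close> is option-valued; \<open>B_form_inverse\<close> below shows that the inverse exists.\<close>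

definition B_involution :: "nat \<Rightarrow> nat \<Rightarrow> 'a::field mat \<Rightarrow> 'a mat" where
  "B_involution q s X = the (mat_inverse (B_form q s)) * transpose_mat X * B_form q s"

definition so_algebra :: "nat \<Rightarrow> nat \<Rightarrow> 'a::field mat set" where
  "so_algebra q s = {X \<in> carrier_mat (q + 2 * s) (q + 2 * s). B_involution q s X = - X}"

definition Gamma_B :: "nat \<Rightarrow> nat \<Rightarrow> 'a::field mat set set" where
  "Gamma_B q s = {R_component q s g \<inter> so_algebra q s | g. g \<in> B_group q s} -
     {{0\<^sub>m (q + 2 * s) (q + 2 * s)}}"

text \<open>The action \<open>\<theta>\<close> is only meaningful as a homomorphism from \<open>H\<close> to the automorphisms of \<open>N\<close>.\<close>

definition semidirect_product ::
  "('a, 'm) monoid_scheme \<Rightarrow> ('b, 'k) monoid_scheme \<Rightarrow> ('b \<Rightarrow> 'a \<Rightarrow> 'a) \<Rightarrow> ('a \<times> 'b) monoid" where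
  "semidirect_product N H \<theta> =
     \<lparr>carrier = carrier N \<times> carrier H,
      monoid.mult = (\<lambda>(a, h) (b, k). (a \<otimes>\<^bsub>N\<^esub> \<theta> h b, h \<otimes>\<^bsub>H\<^esub> k)),
      one = (\<one>\<^bsub>N\<^esub>, \<one>\<^bsub>H\<^esub>)\<rparr>"

definition wreath_Z2_Sym :: "nat \<Rightarrow> ((nat \<Rightarrow> int) \<times> (nat \<Rightarrow> nat)) monoid" where
  "wreath_Z2_Sym s = semidirect_product
     (product_group {1..s} (\<lambda>_. integer_mod_group 2)) (sym_group s)
     (\<lambda>\<sigma> a. \<lambda>i\<in>{1..s}. a (inv' \<sigma> i))"

definition B_dual :: "nat \<Rightarrow> nat \<Rightarrow> nat" where
  "B_dual q i = (if i < q then i else if even (i - q) then i + 1 else i - 1)"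

lemma B_dual_fixed: "i < q \<Longrightarrow> B_dual q i = i"
  by (simp add: B_dual_def)

lemma B_dual_shift: "B_dual q (q + k) = q + B_dual 0 k"
  by (auto simp: B_dual_def elim!: oddE)

lemma B_dual_0_dual: "B_dual 0 (B_dual 0 k) = k"
  by (auto simp: B_dual_def elim!: oddE)

lemma B_dual_0_less: "k < 2 * s \<Longrightarrow> B_dual 0 k < 2 * s"
  by (auto simp: B_dual_def elim!: evenE)

lemma B_dual_less: "i < q + 2 * s \<Longrightarrow> B_dual q i < q + 2 * s"
  by (cases "i < q") (auto simp: B_dual_fixed B_dual_shift B_dual_0_less dest!: leI le_Suc_ex)

lemma B_dual_dual: "B_dual q (B_dual q i) = i"
  by (cases "i < q") (auto simp: B_dual_fixed B_dual_shift B_dual_0_dual dest!: leI le_Suc_ex)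

lemma diag_swap_blocks:
  "diag_block_mat (replicate s (mat_of_rows_list 2 [[0, 1], [1, 0]])) =
     (mat (2 * s) (2 * s) (\<lambda>(i, j). if j = B_dual 0 i then 1 else 0) :: 'a::field mat)"
proof (induction s)
  case 0
  show ?case by (auto intro!: eq_matI)
next
  case (Suc s)
  let ?B = "mat_of_rows_list 2 [[0, 1], [1, 0]] :: 'a mat"
  have d: "dim_row ?B = 2" "dim_col ?B = 2" by (auto simp: mat_of_rows_list_def)
  have B: "?B $$ (i, j) = (if j = B_dual 0 i then 1 else 0)" if "i < 2" "j < 2" for i j
    using that by (auto simp: mat_of_rows_list_def B_dual_def less_2_cases_iff)
  have e: "j = B_dual 0 i \<longleftrightarrow> j \<ge> 2 \<and> j - 2 = B_dual 0 (i - 2)" if "i \<ge> 2" for i j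
    using that by (auto simp: B_dual_def elim!: oddE evenE)
  have f: "B_dual 0 i < 2" if "i < 2" for i
    using that by (auto simp: B_dual_def less_2_cases_iff)
  show ?case
    unfolding replicate_Suc diag_block_mat.simps Let_def Suc.IH
    by (rule eq_matI) (auto simp: d B e f dest: f)
qed

lemma B_form_eq:
  "B_form q s = (mat (q + 2 * s) (q + 2 * s) (\<lambda>(i, j). if j = B_dual q i then 1 else 0) :: 'a::field mat)"
proof -
  have e: "j = B_dual q i \<longleftrightarrow> j \<ge> q \<and> j - q = B_dual 0 (i - q)" if "i \<ge> q" for i j
    using that by (auto simp: B_dual_shift dest!: le_Suc_ex)
  have f: "B_dual q i = i" if "i < q" for i
    using that by (rule B_dual_fixed)
  show ?thesis
    unfolding B_form_def diag_block_mat.simps Let_def diag_swap_blocks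
    by (rule eq_matI) (auto simp: e f)
qed

lemma B_form_carrier: "(B_form q s :: 'a::field mat) \<in> carrier_mat (q + 2 * s) (q + 2 * s)"
  by (simp add: B_form_eq)

lemma B_form_square:
  "B_form q s * B_form q s = (1\<^sub>m (q + 2 * s) :: 'a::field mat)"
  by (rule eq_matI)
    (auto simp: B_form_eq scalar_prod_def B_dual_dual B_dual_less if_distrib[of "\<lambda>x. x * _"]
      cong: if_cong)

lemma B_form_inverse: "mat_inverse (B_form q s) = Some (B_form q s :: 'a::field mat)"
proof (cases "mat_inverse (B_form q s :: 'a mat)")
  case None
  have "(B_form q s :: 'a mat) \<in> Units (ring_mat TYPE('a) (q + 2 * s) ())"
    using B_form_carrier[of q s] B_form_square[of q s]
    by (auto simp: Units_def ring_mat_simps)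
  with mat_inverse(1)[OF B_form_carrier None, of "()"] show ?thesis by blast
next
  case (Some C)
  note C = mat_inverse(2)[OF B_form_carrier Some]
  have "C = (B_form q s * B_form q s) * C" unfolding B_form_square using C by auto
  also have "\<dots> = B_form q s * (B_form q s * C)"
    using C B_form_carrier[of q s] by (intro assoc_mult_mat) auto
  also have "\<dots> = B_form q s" using C right_mult_one_mat[OF B_form_carrier] by simp
  finally show ?thesis using Some by simp
qed

lemma R_component_eq:
  "R_component q s g = {X \<in> carrier_mat (q + 2 * s) (q + 2 * s) :: 'a::field mat set.
     \<forall>i < q + 2 * s. \<forall>j < q + 2 * s. X $$ (i, j) \<noteq> 0 \<longrightarrow> B_deg q s i j = g}"
proof -
  let ?n = "q + 2 * s"
  let ?S = "{matrix_unit ?n i j | i j. i < ?n \<and> j < ?n \<and> B_deg q s i j = g} :: 'a mat set"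
  let ?N = "{X \<in> carrier_mat ?n ?n. \<forall>i < ?n. \<forall>j < ?n. X $$ (i, j) \<noteq> 0 \<longrightarrow> B_deg q s i j = g} :: 'a mat set"
  interpret V: matrix_vs ?n ?n "TYPE('a)" .
  have S: "?S \<subseteq> carrier_mat ?n ?n" by (auto simp: matrix_unit_def)
  have sub: "submodule class_ring ?N V.V"
  proof (rule LinearCombinations.submodule.intro)
    show "Module.module class_ring V.V" by (rule V.module_axioms)
    show "?N \<subseteq> carrier V.V" by (auto simp: module_mat_simps)
    show "\<zero>\<^bsub>V.V\<^esub> \<in> ?N" by (auto simp: module_mat_simps)
    show "X \<oplus>\<^bsub>V.V\<^esub> Y \<in> ?N" if "X \<in> ?N" "Y \<in> ?N" for X Y
    proof -
      have "B_deg q s i j = g" if "i < ?n" "j < ?n" "X $$ (i, j) + Y $$ (i, j) \<noteq> 0" for i j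
        using \<open>X \<in> ?N\<close> \<open>Y \<in> ?N\<close> that by (cases "X $$ (i, j) = 0") simp_all
      then show ?thesis using that by (auto simp: module_mat_simps)
    qed
    show "c \<odot>\<^bsub>V.V\<^esub> X \<in> ?N" if "X \<in> ?N" for c X
      using that by (auto simp: module_mat_simps)
  qed
  have "V.span ?S \<subseteq> ?N"
    by (rule V.span_is_subset[OF _ sub]) (auto simp: matrix_unit_def split: if_splits)
  moreover have "X \<in> V.span ?S" if X: "X \<in> ?N" for X
  proof -
    let ?P = "\<lambda>A. mat ?n ?n (\<lambda>p. if p \<in> A then X $$ p else 0)"
    have "?P A \<in> V.span ?S" if "finite A" "A \<subseteq> {0..<?n} \<times> {0..<?n}" for A
      using that
    proof (induction A rule: finite_induct)
      case empty
      have "?P {} = 0\<^sub>m ?n ?n" by (auto intro!: eq_matI)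
      then show ?case using V.span_zero[of ?S] by (simp del: mat_carrier)
    next
      case (insert p A)
      obtain i j where p: "p = (i, j)" and ij: "i < ?n" "j < ?n" using insert.prems by (cases p) auto
      have eq: "?P (insert p A) = X $$ p \<cdot>\<^sub>m matrix_unit ?n i j + ?P A"
        using insert.hyps by (auto intro!: eq_matI simp: matrix_unit_def p)
      have "X $$ p \<cdot>\<^sub>m matrix_unit ?n i j \<in> V.span ?S"
      proof (cases "X $$ p = 0")
        case True
        then have "X $$ p \<cdot>\<^sub>m matrix_unit ?n i j = 0\<^sub>m ?n ?n"
          by (auto intro!: eq_matI simp: matrix_unit_def)
        then show ?thesis using V.span_zero[of ?S] by simp
      next
        case False
        then have "matrix_unit ?n i j \<in> ?S" using X ij p by auto
        then have "matrix_unit ?n i j \<in> V.span ?S" using V.in_own_span[OF S] by blast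
        then show ?thesis using LinearCombinations.submodule.smult_closed[OF V.span_is_submodule[OF S], of "X $$ p"]
          by (simp add: module_mat_simps class_ring_simps)
      qed
      moreover have "?P A \<in> V.span ?S" using insert by auto
      ultimately show ?case unfolding eq by (rule V.span_add1[OF S])
    qed
    from this[of "{0..<?n} \<times> {0..<?n}"] have "?P ({0..<?n} \<times> {0..<?n}) \<in> V.span ?S" by simp
    moreover have "?P ({0..<?n} \<times> {0..<?n}) = X" using X by (auto intro!: eq_matI)
    ultimately show ?thesis by simp
  qed
  ultimately show ?thesis unfolding R_component_def by blast
qed

end

theory Submission
  imports Defs
begin

text \<open>
  Write \<open>d\<close> for the permutation of the indices that fixes the first \<open>q\<close> of them and swaps the
  members of each of the \<open>s\<close> pairs.  Identifying the skew matrices with the exterior square of the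
  natural module, \<open>e\<^sub>i \<and> e\<^sub>j = E\<^sub>i\<^sub>,\<^sub>d\<^sub>j - E\<^sub>j\<^sub>,\<^sub>d\<^sub>i\<close>, the components of the grading are the diagonal
  matrices (if \<open>s > 0\<close>) and the lines spanned by \<open>e\<^sub>i \<and> e\<^sub>j\<close>, one for each pair \<open>{i, j}\<close> with
  \<open>j \<noteq> i, d i\<close>.  The Weyl group is the group of permutations of the components induced by
  automorphisms.  Permutations of the indices that commute with \<open>d\<close> act on matrices by conjugation and
  give such automorphisms.  Conversely, an automorphism preserves the relation \<open>the bracket of
  two components meets a third one\<close>.  This relation singles out the diagonal component, and on the lines
  it determines \<open>{i, j} \<mapsto> {d i, d j}\<close> and the products \<open>{i, j}, {d j, l} \<mapsto> {i, l}\<close>; from this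
  combinatorial structure alone the index set with its map \<open>d\<close> can be reconstructed, so the
  automorphism permutes the components like a permutation of the indices that commutes with \<open>d\<close>.  No knowledge of the
  automorphism group of the Lie algebra is needed.  The centralizer of \<open>d\<close> in the symmetric group
  is the product of \<open>Sym(q)\<close> and a wreath product.
\<close>

section \<open>Permutations of pairs of indices\<close>

text \<open>\<open>d\<close> abstracts \<open>B_dual q\<close>. It is an involution of all natural
  numbers, so that rewriting with \<open>d (d i) = i\<close> carries no side condition, and it
  preserves the indices below n.\<close>

locale involution_pairs =
  fixes n :: nat and d :: "nat \<Rightarrow> nat"
  assumes n_ge: "5 \<le> n"
    and d_less: "\<And>i. i < n \<Longrightarrow> d i < n"
    and d_d [simp]: "\<And>i. d (d i) = i"
    and fixed_point: "\<exists>i<n. d i = i"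
begin

lemma d_less_iff [simp]: "d i < n \<longleftrightarrow> i < n"
  using d_less[of i] d_less[of "d i"] by auto

lemma d_eq_iff [simp]: "d i = d j \<longleftrightarrow> i = j"
  using d_d by metis

text \<open>The indices lie in different orbits of \<open>d\<close>. This is the condition for
  \<open>e\<^sub>i \<and> e\<^sub>j\<close> to be nonzero and not diagonal.\<close>

definition apart :: "nat \<Rightarrow> nat \<Rightarrow> bool" where
  "apart i j \<longleftrightarrow> i < n \<and> j < n \<and> i \<noteq> j \<and> i \<noteq> d j"

lemma apart_sym: "apart i j \<longleftrightarrow> apart j i"
  unfolding apart_def using d_d by metis

lemma apart_d1 [simp]: "apart (d i) j \<longleftrightarrow> apart i j"
  unfolding apart_def using d_d d_less_iff d_eq_iff by metis

lemma apart_d2 [simp]: "apart i (d j) \<longleftrightarrow> apart i j"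
  unfolding apart_def using d_d d_less_iff by metis

lemma apart_neq: "apart i j \<Longrightarrow> i \<noteq> j" "apart i j \<Longrightarrow> i \<noteq> d j" "apart i j \<Longrightarrow> d i \<noteq> j"
  "apart i j \<Longrightarrow> i < n" "apart i j \<Longrightarrow> j < n"
  using apart_d1 by (auto simp: apart_def)

text \<open>The orbits of i and j cover at most four indices, and there are at least five.\<close>

lemma ex_apart: "\<exists>k. apart i k \<and> apart j k" if "i < n" "j < n"
proof -
  have "card {i, d i, j, d j} \<le> 4" by (simp add: card_insert_if)
  then have "\<not> {..<n} \<subseteq> {i, d i, j, d j}"
    using n_ge card_mono[of "{i, d i, j, d j}" "{..<n}"] by auto
  then obtain k where "k < n" "k \<notin> {i, d i, j, d j}" by auto
  then show ?thesis using that by (intro exI[of _ k]) (auto simp: apart_def)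
qed

text \<open>These label the one-dimensional components; they are unordered because exchanging i and
  j only changes the sign of \<open>e\<^sub>i \<and> e\<^sub>j\<close>.\<close>

definition pairs :: "nat set set" where
  "pairs = {{i, j} | i j. apart i j}"

lemma pairs_iff [simp]: "{i, j} \<in> pairs \<longleftrightarrow> apart i j"
  unfolding pairs_def by (auto simp: doubleton_eq_iff apart_sym)

lemma pairsE:
  assumes "u \<in> pairs" obtains i j where "u = {i, j}" "apart i j"
  using assms by (auto simp: pairs_def)

lemma pairs_memE:
  assumes u: "u \<in> pairs" and i: "i \<in> u" obtains j where "u = {i, j}" "apart i j"
proof -
  obtain a b where ab: "u = {a, b}" "apart a b" using u by (rule pairsE)
  show thesis
  proof (cases "i = a")
    case False
    then have "u = {i, a}" "apart i a" using ab i by (auto simp: apart_sym)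
    then show thesis by (rule that)
  qed (use ab that in simp)
qed

lemma finite_pairs: "finite pairs"
  by (rule finite_subset[of _ "Pow {..<n}"]) (auto simp: pairs_def apart_def)

lemma dual_pairs: "u \<in> pairs \<Longrightarrow> d ` u \<in> pairs"
  by (auto elim!: pairsE)

text \<open>The members of a pair lie in different orbits, so \<open>d\<close> cannot interchange
  them.\<close>

lemma dual_fixed_iff: "u \<in> pairs \<Longrightarrow> d ` u = u \<longleftrightarrow> (\<forall>i\<in>u. d i = i)"
  by (elim pairsE) (auto simp: doubleton_eq_iff dest: apart_neq)

text \<open>In terms of roots, \<open>u\<close>, \<open>v\<close>, \<open>w\<close> are \<open>\<epsilon>\<^sub>i + \<epsilon>\<^sub>j\<close>, \<open>- \<epsilon>\<^sub>j + \<epsilon>\<^sub>l\<close>, \<open>\<epsilon>\<^sub>i + \<epsilon>\<^sub>l\<close>.\<close>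

definition brel :: "nat set \<Rightarrow> nat set \<Rightarrow> nat set \<Rightarrow> bool" where
  "brel u v w \<longleftrightarrow> (\<exists>i j l. apart i j \<and> apart j l \<and> apart i l \<and>
     u = {i, j} \<and> v = {d j, l} \<and> w = {i, l})"

lemma brel_pairs: "brel u v w \<Longrightarrow> u \<in> pairs \<and> v \<in> pairs \<and> w \<in> pairs"
  by (auto simp: brel_def)

lemma brelI: "apart i j \<Longrightarrow> apart j l \<Longrightarrow> apart i l \<Longrightarrow> brel {i, j} {d j, l} {i, l}"
  unfolding brel_def by blast

text \<open>The index through which u and v are chained is unique: if the other member i of u also
  had \<open>d i\<close> in v, then i would equal j or \<open>d l\<close>, against
  \<open>apart\<close>.\<close>

lemma brelE:
  assumes "brel u v w" "j \<in> u" "d j \<in> v"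
  obtains i l where "u = {i, j}" "v = {d j, l}" "w = {i, l}" "apart i j" "apart j l" "apart i l"
proof -
  obtain a b c where *: "apart a b" "apart b c" "apart a c" "u = {a, b}" "v = {d b, c}" "w = {a, c}"
    using assms(1) unfolding brel_def by blast
  have "j = b" using * assms(2,3) by (auto dest: apart_neq)
  with * show thesis using that[of a c] by simp
qed

text \<open>Both triples are chained through the same index j, and the third pair consists of the
  remaining members of u and v.\<close>

lemma brel_unique: "brel u v w \<Longrightarrow> brel u v w' \<Longrightarrow> w = w'"
proof -
  assume "brel u v w" "brel u v w'"
  then obtain j where j: "j \<in> u" "d j \<in> v" unfolding brel_def by blast
  from \<open>brel u v w\<close> j obtain i l where 1: "u = {i, j}" "v = {d j, l}" "w = {i, l}" "apart i j" "apart j l"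
    by (rule brelE)
  from \<open>brel u v w'\<close> j obtain i' l' where 2: "u = {i', j}" "v = {d j, l'}" "w' = {i', l'}" "apart i' j" "apart j l'"
    by (rule brelE)
  show ?thesis using 1 2 by (metis doubleton_eq_iff)
qed

definition centralizer :: "(nat \<Rightarrow> nat) set" where
  "centralizer = {\<pi>. \<pi> permutes {..<n} \<and> (\<forall>i<n. \<pi> (d i) = d (\<pi> i))}"

end

section \<open>Reconstruction of an index permutation from its effect on pairs\<close>

locale pairs_aut = involution_pairs +
  fixes F :: "nat set \<Rightarrow> nat set"
  assumes F_bij: "bij_betw F pairs pairs"
    and F_brel: "\<And>u v w. u \<in> pairs \<Longrightarrow> v \<in> pairs \<Longrightarrow> w \<in> pairs \<Longrightarrow> brel u v w \<longleftrightarrow> brel (F u) (F v) (F w)"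
    and F_dual: "\<And>u. u \<in> pairs \<Longrightarrow> F (d ` u) = d ` F u"
begin

lemma F_pairs: "u \<in> pairs \<Longrightarrow> F u \<in> pairs"
  using F_bij by (auto dest: bij_betwE)

lemma F_inj: "u \<in> pairs \<Longrightarrow> v \<in> pairs \<Longrightarrow> F u = F v \<longleftrightarrow> u = v"
  using F_bij by (auto simp: bij_betw_def inj_on_eq_iff)

lemma F_surj: "v \<in> pairs \<Longrightarrow> \<exists>u\<in>pairs. v = F u"
  using F_bij by (auto simp: bij_betw_def)

lemma F_brelI: "apart i j \<Longrightarrow> apart j l \<Longrightarrow> apart i l \<Longrightarrow> brel (F {i, j}) (F {d j, l}) (F {i, l})"
  by (subst F_brel[symmetric]) (auto intro: brelI)

text \<open>Pairs of fixed points are the self-dual ones by \<open>dual_fixed_iff\<close>, and F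
  respects duality.\<close>

lemma F_fixed_iff: "u \<in> pairs \<Longrightarrow> (\<forall>i\<in>F u. d i = i) \<longleftrightarrow> (\<forall>i\<in>u. d i = i)"
  using F_dual[of u] F_inj[of "d ` u" u] dual_fixed_iff[of u] dual_fixed_iff[of "F u"]
    F_pairs[of u] dual_pairs[of u] by auto

text \<open>Compare root strings. Pairs of moved points are long roots: after one step from v to
  \<open>{i, l}\<close> no index of u has its dual in \<open>{i, l}\<close>. If u contains a fixed
  point i, then \<open>{d j, l}\<close>, \<open>{i, l}\<close>, \<open>{j, l}\<close> is a string
  with two steps.\<close>

lemma no_fixed_iff: 
  assumes u: "u \<in> pairs"
  shows "(\<forall>i\<in>u. d i \<noteq> i) \<longleftrightarrow> \<not> (\<exists>v w x. v \<in> pairs \<and> w \<in> pairs \<and> x \<in> pairs \<and> brel u v w \<and> brel u w x)"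
    (is "?L \<longleftrightarrow> \<not> ?R")
proof
  assume L: ?L
  show "\<not> ?R"
  proof clarify
    fix v w x assume "brel u v w" and uwx: "brel u w x"
    then obtain i j l where *: "apart i j" "apart j l" "apart i l" "u = {i, j}" "v = {d j, l}" "w = {i, l}"
      unfolding brel_def by blast
    from uwx obtain b where "b \<in> u" "d b \<in> w" unfolding brel_def by blast
    with * L show False by (auto dest: apart_neq)
  qed
next
  assume R: "\<not> ?R"
  show ?L
  proof clarify
    fix i assume "i \<in> u" "d i = i"
    with u obtain j where j: "u = {i, j}" "apart i j" by (auto elim: pairs_memE)
    obtain l where l: "apart i l" "apart j l" using ex_apart[of i j] apart_neq(4,5)[OF j(2)] by blast
    have "brel {i, j} {d j, l} {i, l}" using j l by (intro brelI) auto
    \<comment> \<open>The second step is chained through i; there \<open>{d i, l}\<close> is the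
      pair \<open>{i, l}\<close> reached by the first step.\<close>
    moreover have "brel {j, i} {d i, l} {j, l}" using j l by (intro brelI) (auto simp: apart_sym)
    ultimately show False using R j l brel_pairs \<open>d i = i\<close> by (metis insert_commute)
  qed
qed

text \<open>The criterion \<open>no_fixed_iff\<close> is stated by \<open>brel\<close> alone, so it
  can be carried along F and back.\<close>

lemma F_no_fixed_iff: assumes u: "u \<in> pairs" shows "(\<forall>i\<in>F u. d i \<noteq> i) \<longleftrightarrow> (\<forall>i\<in>u. d i \<noteq> i)"
proof -
  have "(\<exists>v w x. v \<in> pairs \<and> w \<in> pairs \<and> x \<in> pairs \<and> brel (F u) v w \<and> brel (F u) w x) \<longleftrightarrow>
     (\<exists>v w x. v \<in> pairs \<and> w \<in> pairs \<and> x \<in> pairs \<and> brel u v w \<and> brel u w x)" (is "?L \<longleftrightarrow> ?R")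
  proof
    assume ?L
    then obtain v w x where 1: "v \<in> pairs" "w \<in> pairs" "x \<in> pairs" "brel (F u) v w" "brel (F u) w x"
      by blast
    moreover obtain v' w' x' where "v' \<in> pairs" "w' \<in> pairs" "x' \<in> pairs" "v = F v'" "w = F w'" "x = F x'"
      using F_surj[OF 1(1)] F_surj[OF 1(2)] F_surj[OF 1(3)] by blast
    ultimately show ?R using F_brel[OF u] by blast
  next
    assume ?R
    then obtain v w x where "v \<in> pairs" "w \<in> pairs" "x \<in> pairs" "brel u v w" "brel u w x"
      by blast
    then show ?L using F_brel[OF u] F_pairs by (intro exI[of _ "F v"] exI[of _ "F w"] exI[of _ "F x"]) auto
  qed
  then show ?thesis unfolding no_fixed_iff[OF u] no_fixed_iff[OF F_pairs[OF u]] by simp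
qed

lemma F_eq_image:
  assumes "u \<in> pairs" "\<pi> \<in> centralizer" "\<And>i j. apart i j \<Longrightarrow> F {i, j} = {\<pi> i, \<pi> j}"
  shows "F u = \<pi> ` u"
  using assms by (auto elim!: pairsE)

text \<open>Without non-fixed points \<open>F\<close> is an automorphism of the line graph of the complete graph; stars
  are told from triangles since \<open>brel\<close> recognises triangles.\<close>

lemma all_fixed_case:
  assumes fx: "\<And>i. i < n \<Longrightarrow> d i = i"
  shows "\<exists>\<pi>\<in>centralizer. \<forall>u\<in>pairs. F u = \<pi> ` u"
proof -
  have ap: "apart i j \<longleftrightarrow> i < n \<and> j < n \<and> i \<noteq> j" for i j
    using fx by (auto simp: apart_def)
  \<comment> \<open>With \<open>d\<close> trivial, \<open>brel\<close> holds exactly for the three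
    sides of a triangle.\<close>
  have tri: "\<exists>a b c. F {i, j} = {a, b} \<and> F {i, k} = {a, c} \<and> F {j, k} = {b, c} \<and> apart a b \<and> apart a c \<and> apart b c"
    if "apart i j" "apart i k" "apart j k" for i j k
  proof -
    have "brel (F {j, i}) (F {d i, k}) (F {j, k})" using that by (intro F_brelI) (auto simp: apart_sym)
    then obtain a b c where "apart b a" "apart a c" "apart b c" "F {j, i} = {b, a}"
      "F {d i, k} = {d a, c}" "F {j, k} = {b, c}" unfolding brel_def by blast
    then show ?thesis using fx that by (metis ap insert_commute)
  qed
  have "\<exists>p. p < n \<and> (\<forall>j. apart i j \<longrightarrow> p \<in> F {i, j})" if i: "i < n" for i
  proof -
    obtain j where j: "apart i j" using ex_apart i by blast
    obtain k where k: "apart i k" "apart j k" using ex_apart[of i j] i j ap by blast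
    obtain a b c where abc: "F {i, j} = {a, b}" "F {i, k} = {a, c}" "F {j, k} = {b, c}" "apart a b" "apart a c" "apart b c"
      using tri[OF j k] by blast
    have "a \<in> F {i, l}" if l: "apart i l" for l
    proof (cases "l = j \<or> l = k")
      case True then show ?thesis using abc by auto
    next
      case False
      then have l': "apart j l" "apart k l" using l j k by (auto simp: ap)
      obtain a1 b1 c1 where 1: "F {i, j} = {a1, b1}" "F {i, l} = {a1, c1}" "apart a1 c1" using tri[OF j l l'(1)] by blast
      obtain a2 b2 c2 where 2: "F {i, k} = {a2, b2}" "F {i, l} = {a2, c2}" "apart a2 c2" using tri[OF k(1) l l'(2)] by blast
      \<comment> \<open>\<open>F {i, l}\<close> meets both \<open>{a, b}\<close> and
        \<open>{a, c}\<close>. If it avoided a, it would be \<open>{b, c}\<close>, which is already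
        the image of \<open>{j, k}\<close>.\<close>
      have "F {i, l} \<noteq> F {j, k}" using l k j False by (subst F_inj) (auto simp: doubleton_eq_iff ap)
      then show ?thesis using abc 1 2 by (auto simp: doubleton_eq_iff ap)
    qed
    then show ?thesis using abc(4) apart_neq by blast
  qed
  then obtain p where p: "\<And>i. i < n \<Longrightarrow> p i < n" "\<And>i j. apart i j \<Longrightarrow> p i \<in> F {i, j}"
    unfolding ap by metis
  have p2: "p j \<in> F {i, j}" if "apart i j" for i j
    using p(2)[of j i] that by (simp add: apart_sym insert_commute)
  have pne: "p i \<noteq> p j" if ij: "apart i j" for i j
  proof
    assume e: "p i = p j"
    obtain k where k: "apart i k" "apart j k" using ex_apart[of i j] apart_neq(4,5)[OF ij] by blast
    obtain a b c where abc: "F {i, j} = {a, b}" "F {i, k} = {a, c}" "F {j, k} = {b, c}" "apart a b" "apart a c" "apart b c"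
      using tri[OF ij k] by blast
    \<comment> \<open>The common value would lie on all three sides of the image triangle, which
      share no point.\<close>
    show False using p(2)[OF ij] p(2)[OF k(1)] p(2)[OF k(2)] e abc by (auto simp: ap)
  qed
  define \<pi> where "\<pi> i = (if i < n then p i else i)" for i
  have inj: "inj_on \<pi> {..<n}" using pne by (auto simp: inj_on_def \<pi>_def ap)
  have "\<pi> ` {..<n} \<subseteq> {..<n}" using p(1) by (auto simp: \<pi>_def)
  then have "bij_betw \<pi> {..<n} {..<n}" using inj by (simp add: bij_betw_def endo_inj_surj)
  then have perm: "\<pi> permutes {..<n}" by (rule bij_imp_permutes) (auto simp: \<pi>_def)
  then have cen: "\<pi> \<in> centralizer" using fx p(1) by (auto simp: centralizer_def \<pi>_def)
  have "F {i, j} = {\<pi> i, \<pi> j}" if ij: "apart i j" for i j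
  proof -
    obtain a b where "F {i, j} = {a, b}" using F_pairs[of "{i, j}"] ij by (auto elim!: pairsE)
    then show ?thesis using p(2)[OF ij] p2[OF ij] pne[OF ij] apart_neq[OF ij] by (auto simp: \<pi>_def)
  qed
  then show ?thesis using cen F_eq_image by blast
qed

text \<open>If there are both fixed and non-fixed points, the mixed pairs form a grid (the short root
  spaces), and \<open>F\<close> preserves its rows and columns.\<close>

lemma mixed_case:
  assumes j0: "j0 < n" "d j0 \<noteq> j0"
  shows "\<exists>\<pi>\<in>centralizer. \<forall>u\<in>pairs. F u = \<pi> ` u"
proof -
  define fx where "fx i \<longleftrightarrow> i < n \<and> d i = i" for i
  define mv where "mv i \<longleftrightarrow> i < n \<and> d i \<noteq> i" for i
  have mv_d [simp]: "mv (d i) \<longleftrightarrow> mv i" for i by (metis d_d d_less_iff mv_def)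
  have fx_d: "fx i \<Longrightarrow> d i = i" for i by (simp add: fx_def)
  have fx_mv: "fx i \<Longrightarrow> mv j \<Longrightarrow> apart i j" for i j
    unfolding fx_def mv_def apart_def by (metis d_d)
  have fx_fx: "fx i \<Longrightarrow> fx j \<Longrightarrow> apart i j \<longleftrightarrow> i \<noteq> j" for i j
    unfolding fx_def apart_def by auto
  have not_both: "fx i \<Longrightarrow> mv i \<Longrightarrow> False" for i by (simp add: fx_def mv_def)
  have fx_or: "i < n \<Longrightarrow> fx i \<or> mv i" for i by (auto simp: fx_def mv_def)
  obtain i0 where i0: "fx i0" using fixed_point by (auto simp: fx_def)
  have j0: "mv j0" using j0 by (simp add: mv_def)
  \<comment> \<open>F preserves the pairs of two fixed points and those of two moved points, hence
    also the mixed ones.\<close>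
  have "\<exists>a b. F {i, j} = {a, b} \<and> fx a \<and> mv b" if "fx i" "mv j" for i j
  proof -
    have P: "{i, j} \<in> pairs" using that fx_mv by simp
    have "\<not> (\<forall>i\<in>F {i, j}. d i = i)" using F_fixed_iff[OF P] that by (auto simp: fx_def mv_def)
    moreover have "\<not> (\<forall>i\<in>F {i, j}. d i \<noteq> i)" using F_no_fixed_iff[OF P] that by (auto simp: fx_def mv_def)
    moreover obtain a b where "F {i, j} = {a, b}" "apart a b" using F_pairs[OF P] by (auto elim!: pairsE)
    ultimately show ?thesis using apart_neq(4,5)[of a b] by (auto simp: fx_def mv_def doubleton_eq_iff)
  qed
  then obtain a b where ab: "\<And>i j. fx i \<Longrightarrow> mv j \<Longrightarrow> F {i, j} = {a i j, b i j}"
    "\<And>i j. fx i \<Longrightarrow> mv j \<Longrightarrow> fx (a i j)" "\<And>i j. fx i \<Longrightarrow> mv j \<Longrightarrow> mv (b i j)" by metis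
  have dual: "a i (d j) = a i j \<and> b i (d j) = d (b i j)" if "fx i" "mv j" for i j
  proof -
    have "F (d ` {i, j}) = d ` F {i, j}" using that fx_mv by (intro F_dual) auto
    then have "{a i (d j), b i (d j)} = {a i j, d (b i j)}" using that ab[of i j] ab[of i "d j"] fx_d by simp
    then show ?thesis using that ab[of i j] ab[of i "d j"] not_both by (metis doubleton_eq_iff mv_d)
  qed
  \<comment> \<open>The bracket of \<open>{j, i}\<close> and \<open>{i, k}\<close> is
    \<open>{j, k}\<close>, chained through the fixed i. Its image consists of moved points, so the
    image bracket is chained through the fixed member shared by both images.\<close>
  have row: "a i j = a i k" if "fx i" "mv j" "mv k" for i j k
  proof (cases "k = j \<or> k = d j")
    case True then show ?thesis using dual that by auto
  next
    case False
    then have jk: "apart j k" using that unfolding apart_def mv_def by (metis d_d)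
    have "brel (F {j, i}) (F {d i, k}) (F {j, k})"
      using that jk fx_mv by (intro F_brelI) (auto simp: apart_sym)
    then have "brel {a i j, b i j} {a i k, b i k} (F {j, k})"
      using ab(1)[OF that(1,2)] ab(1)[OF that(1,3)] fx_d[OF that(1)] by (simp add: insert_commute)
    then obtain x y z where xyz: "{a i j, b i j} = {x, y}" "{a i k, b i k} = {d y, z}" "F {j, k} = {x, z}" "apart x y"
      unfolding brel_def by blast
    have "d x \<noteq> x" "d z \<noteq> z" using F_no_fixed_iff[of "{j, k}"] jk that xyz(3) by (auto simp: mv_def)
    then show ?thesis using xyz ab[OF that(1,2)] ab[OF that(1,3)] by (auto simp: doubleton_eq_iff fx_def mv_def)
  qed
  \<comment> \<open>Dually, \<open>{i, j}\<close> and \<open>{d j, l}\<close> give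
    \<open>{i, l}\<close>, whose image consists of fixed points. The image bracket is thus chained
    through the moved members, which must agree up to \<open>d\<close>.\<close>
  have col: "b i j = b l j" if "fx i" "fx l" "mv j" for i j l
  proof (cases "l = i")
    case False
    then have il: "apart i l" using that fx_fx by auto
    have "brel (F {i, j}) (F {d j, l}) (F {i, l})"
      using that il fx_mv[of i j] fx_mv[of l j] by (intro F_brelI) (auto simp: apart_sym)
    moreover have "F {d j, l} = {a l j, d (b l j)}" using ab(1)[of l "d j"] dual[of l j] that by (simp add: insert_commute)
    ultimately have "brel {a i j, b i j} {a l j, d (b l j)} (F {i, l})" using ab(1)[OF that(1,3)] by simp
    then obtain x y z where xyz: "{a i j, b i j} = {x, y}" "{a l j, d (b l j)} = {d y, z}" "F {i, l} = {x, z}" "apart x y"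
      unfolding brel_def by blast
    have "d x = x" "d z = z" using F_fixed_iff[of "{i, l}"] il that xyz(3) by (auto simp: fx_def)
    then show ?thesis using xyz ab[OF that(1,3)] ab[OF that(2,3)] by (auto simp: doubleton_eq_iff fx_def mv_def)
  qed simp
  \<comment> \<open>By \<open>row\<close> and \<open>col\<close>, \<open>a\<close> depends on the
    fixed index only and \<open>b\<close> on the moved index only, so \<open>j0\<close> and
    \<open>i0\<close> stand for arbitrary choices.\<close>
  define \<pi> where "\<pi> i = (if fx i then a i j0 else if mv i then b i0 i else i)" for i
  have \<pi>_fx: "fx (\<pi> i)" if "fx i" for i using that ab j0 by (simp add: \<pi>_def)
  have \<pi>_mv: "mv (\<pi> i)" if "mv i" for i using that ab(3)[OF i0 that] not_both[of i] by (auto simp: \<pi>_def)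
  have F_mixed: "F {i, j} = {\<pi> i, \<pi> j}" if "fx i" "mv j" for i j
    using that ab(1)[OF that] row[OF that j0] col[OF that(1) i0 that(2)] not_both[of j] by (auto simp: \<pi>_def)
  have inj: "\<pi> i = \<pi> j \<Longrightarrow> i = j" if "i < n" "j < n" for i j
  proof -
    assume e: "\<pi> i = \<pi> j"
    have "fx i \<and> fx j \<or> mv i \<and> mv j" using fx_or[OF that(1)] fx_or[OF that(2)] \<pi>_fx \<pi>_mv e not_both by metis
    then show "i = j"
    proof
      assume *: "fx i \<and> fx j"
      then have "F {i, j0} = F {j, j0}" using F_mixed j0 e by simp
      then have "{i, j0} = {j, j0}" using * j0 fx_mv by (subst (asm) F_inj) auto
      then show "i = j" by (auto simp: doubleton_eq_iff)
    next
      assume *: "mv i \<and> mv j"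
      then have "F {i0, i} = F {i0, j}" using F_mixed i0 e by simp
      then have "{i0, i} = {i0, j}" using * i0 fx_mv by (subst (asm) F_inj) auto
      then show "i = j" by (auto simp: doubleton_eq_iff)
    qed
  qed
  have "\<pi> ` {..<n} \<subseteq> {..<n}"
    using fx_or \<pi>_fx \<pi>_mv by (fastforce simp: fx_def mv_def)
  moreover have "inj_on \<pi> {..<n}" using inj by (auto simp: inj_on_def)
  ultimately have "bij_betw \<pi> {..<n} {..<n}" by (simp add: bij_betw_def endo_inj_surj)
  then have perm: "\<pi> permutes {..<n}" by (rule bij_imp_permutes) (auto simp: \<pi>_def fx_def mv_def)
  have comm: "\<pi> (d i) = d (\<pi> i)" if "i < n" for i
  proof (cases "fx i")
    case True then show ?thesis using \<pi>_fx fx_d by simp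
  next
    case False
    then have mv: "mv i" using fx_or that by blast
    then show ?thesis using dual[OF i0 mv] not_both[of "d i"] False by (auto simp: \<pi>_def)
  qed
  have cen: "\<pi> \<in> centralizer" using perm comm by (auto simp: centralizer_def)
  have \<pi>_apart: "apart (\<pi> i) (\<pi> j)" if "apart i j" for i j
    using that inj comm \<pi>_fx \<pi>_mv fx_or unfolding apart_def by (metis d_less_iff fx_def mv_def)
  \<comment> \<open>\<open>brel\<close> determines its third pair, so agreement of F with \<pi>
    passes from two chained pairs to their product.\<close>
  have step: "F {i, l} = {\<pi> i, \<pi> l}" if "F {i, j} = {\<pi> i, \<pi> j}" "F {d j, l} = {\<pi> (d j), \<pi> l}"
    "apart i j" "apart j l" "apart i l" for i j l
  proof -
    have "brel {\<pi> i, \<pi> j} {d (\<pi> j), \<pi> l} (F {i, l})"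
      using F_brelI[OF that(3-5)] that comm apart_neq by metis
    moreover have "brel {\<pi> i, \<pi> j} {d (\<pi> j), \<pi> l} {\<pi> i, \<pi> l}" using that \<pi>_apart by (intro brelI)
    ultimately show ?thesis by (rule brel_unique)
  qed
  \<comment> \<open>Every pair that is not mixed is a product of two mixed ones: a pair of fixed
    points through \<open>j0\<close>, a pair of moved points through \<open>i0\<close>.\<close>
  have "F {i, j} = {\<pi> i, \<pi> j}" if ij: "apart i j" for i j
  proof -
    consider "fx i" "fx j" | "mv i" "mv j" | "fx i" "mv j" | "mv i" "fx j" using fx_or[of i] fx_or[of j] apart_neq(4,5)[OF ij] by blast
    then show ?thesis
    proof cases
      case 1
      have "F {d j0, j} = {\<pi> (d j0), \<pi> j}" using F_mixed[of j "d j0"] 1 j0 by (simp add: insert_commute)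
      then show ?thesis
        using step[of i j0 j] F_mixed[OF 1(1) j0] fx_mv[OF 1(1) j0] fx_mv[OF 1(2) j0] ij by (simp add: apart_sym)
    next
      case 2
      have "F {i, i0} = {\<pi> i, \<pi> i0}" using F_mixed[OF i0 2(1)] by (simp add: insert_commute)
      then show ?thesis
        using step[of i i0 j] F_mixed[OF i0 2(2)] fx_d[OF i0] fx_mv[OF i0 2(1)] fx_mv[OF i0 2(2)] ij
        by (simp add: apart_sym)
    qed (use F_mixed insert_commute in metis)+
  qed
  then show ?thesis using cen F_eq_image by blast
qed

lemma ex_centralizer: "\<exists>\<pi>\<in>centralizer. \<forall>u\<in>pairs. F u = \<pi> ` u"
  using all_fixed_case mixed_case by blast

end

section \<open>The centralizer of the involution and its action on pairs\<close>

context involution_pairs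
begin

lemma centralizer_permutes: "\<pi> \<in> centralizer \<Longrightarrow> \<pi> permutes {..<n}"
  by (simp add: centralizer_def)

lemma centralizer_less: "\<pi> \<in> centralizer \<Longrightarrow> \<pi> i < n \<longleftrightarrow> i < n"
  using permutes_in_image[of \<pi> "{..<n}" i] by (simp add: centralizer_def)

lemma centralizer_dual: "\<pi> \<in> centralizer \<Longrightarrow> i < n \<Longrightarrow> \<pi> (d i) = d (\<pi> i)"
  by (simp add: centralizer_def)

lemma centralizer_inverse:
  assumes \<pi>: "\<pi> \<in> centralizer"
  shows "\<pi> (inv' \<pi> i) = i" "inv' \<pi> (\<pi> i) = i"
  using permutes_inverses[OF centralizer_permutes[OF \<pi>]] by auto

lemma centralizer_inv:
  assumes \<pi>: "\<pi> \<in> centralizer"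
  shows "inv' \<pi> \<in> centralizer"
proof -
  let ?\<rho> = "inv' \<pi>"
  have p: "?\<rho> permutes {..<n}" using permutes_inv[OF centralizer_permutes[OF \<pi>]] .
  have "?\<rho> (d i) = d (?\<rho> i)" if "i < n" for i
  proof -
    have "?\<rho> i < n" using permutes_in_image[OF p, of i] that by simp
    then have "\<pi> (d (?\<rho> i)) = d i" using centralizer_dual[OF \<pi>] centralizer_inverse[OF \<pi>] by simp
    then show ?thesis using centralizer_inverse(2)[OF \<pi>] by metis
  qed
  with p show ?thesis by (simp add: centralizer_def)
qed

lemma centralizer_pairs:
  assumes \<pi>: "\<pi> \<in> centralizer" and u: "u \<in> pairs"
  shows "\<pi> ` u \<in> pairs"
proof -
  obtain i j where ij: "u = {i, j}" "apart i j" using u by (rule pairsE)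
  note ne = apart_neq[OF ij(2)]
  have "apart (\<pi> i) (\<pi> j)"
    unfolding apart_def centralizer_dual[OF \<pi> ne(5), symmetric]
    using ne centralizer_less[OF \<pi>] centralizer_inverse(2)[OF \<pi>] by metis
  with ij show ?thesis by simp
qed

text \<open>Two pairs through a point meet in that point only, so the action on pairs is faithful.\<close>

lemma centralizer_faithful:
  assumes "\<pi> \<in> centralizer" "\<rho> \<in> centralizer" and eq: "\<And>u. u \<in> pairs \<Longrightarrow> \<pi> ` u = \<rho> ` u"
  shows "\<pi> = \<rho>"
proof
  fix i
  show "\<pi> i = \<rho> i"
  proof (cases "i < n")
    case True
    obtain j where j: "apart i j" using ex_apart[of i i] True by blast
    obtain k where k: "apart i k" "apart j k" using ex_apart[of i j] apart_neq[OF j] by blast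
    have "\<pi> ` {i, j} = \<rho> ` {i, j}" "\<pi> ` {i, k} = \<rho> ` {i, k}" using j k by (auto intro!: eq simp del: image_insert)
    then have 1: "{\<pi> i, \<pi> j} = {\<rho> i, \<rho> j}" "{\<pi> i, \<pi> k} = {\<rho> i, \<rho> k}" by simp_all
    moreover have "\<rho> j \<noteq> \<rho> k" "\<pi> j \<noteq> \<pi> k"
      using apart_neq(1)[OF k(2)] centralizer_inverse(2)[OF assms(1)] centralizer_inverse(2)[OF assms(2)] by metis+
    ultimately show ?thesis by (metis doubleton_eq_iff)
  next
    case False
    then have "\<pi> i = i" "\<rho> i = i"
      using assms(1,2)[THEN centralizer_permutes] by (auto intro: permutes_not_in)
    then show ?thesis by simp
  qed
qed

end

section \<open>The action of grading automorphisms on the components\<close>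

text \<open>The inverse bijection is multiplicative as soon as products stay in the carrier of A.
  This allows \<open>model\<close> to be treated as a bare multiplicative structure.\<close>

lemma iso_sym_closed:
  assumes h: "h \<in> iso A B" and closed: "\<And>x y. x \<in> carrier A \<Longrightarrow> y \<in> carrier A \<Longrightarrow> x \<otimes>\<^bsub>A\<^esub> y \<in> carrier A"
  shows "B \<cong> A"
proof -
  have hom: "\<And>x y. x \<in> carrier A \<Longrightarrow> y \<in> carrier A \<Longrightarrow> h (x \<otimes>\<^bsub>A\<^esub> y) = h x \<otimes>\<^bsub>B\<^esub> h y"
    and bij: "bij_betw h (carrier A) (carrier B)"
    using h by (auto simp: iso_def hom_def)
  let ?g = "inv_into (carrier A) h"
  have g: "bij_betw ?g (carrier B) (carrier A)" by (rule bij_betw_inv_into[OF bij])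
  have "?g (x \<otimes>\<^bsub>B\<^esub> y) = ?g x \<otimes>\<^bsub>A\<^esub> ?g y" if "x \<in> carrier B" "y \<in> carrier B" for x y
  proof -
    have gx: "?g x \<in> carrier A" "?g y \<in> carrier A" using bij_betwE[OF g] that by auto
    have "x \<otimes>\<^bsub>B\<^esub> y = h (?g x \<otimes>\<^bsub>A\<^esub> ?g y)"
      using hom[OF gx] that bij by (simp add: bij_betw_inv_into_right)
    then show ?thesis using bij_betw_inv_into_left[OF bij closed[OF gx]] by simp
  qed
  then have "?g \<in> iso B A" using g bij_betwE[OF g] by (auto simp: iso_def hom_def)
  then show ?thesis by (auto simp: is_iso_def)
qed

text \<open>Collects what turns the Weyl group into a permutation group. Maps on L are extensional,
  so compositions and the identity act on components as expected because these lie inside L.\<close>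

locale graded_subalgebra =
  fixes L :: "'a::field mat set" and \<Gamma> :: "'a mat set set"
  assumes add_closed: "\<And>X Y. X \<in> L \<Longrightarrow> Y \<in> L \<Longrightarrow> X + Y \<in> L"
    and smult_closed: "\<And>c X. X \<in> L \<Longrightarrow> c \<cdot>\<^sub>m X \<in> L"
    and bracket_closed: "\<And>X Y. X \<in> L \<Longrightarrow> Y \<in> L \<Longrightarrow> lie_bracket X Y \<in> L"
    and component_sub: "\<And>U. U \<in> \<Gamma> \<Longrightarrow> U \<subseteq> L"
begin

lemma grading_aut_Bij: "f \<in> grading_aut L \<Gamma> \<Longrightarrow> f \<in> Bij L"
  by (simp add: grading_aut_def lie_automorphisms_def)

lemma grading_aut_D:
  assumes "f \<in> grading_aut L \<Gamma>"
  shows "X \<in> L \<Longrightarrow> f X \<in> L" "X \<in> L \<Longrightarrow> Y \<in> L \<Longrightarrow> f (X + Y) = f X + f Y"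
    "X \<in> L \<Longrightarrow> f (c \<cdot>\<^sub>m X) = c \<cdot>\<^sub>m f X"
    "X \<in> L \<Longrightarrow> Y \<in> L \<Longrightarrow> f (lie_bracket X Y) = lie_bracket (f X) (f Y)"
    "bij_betw (\<lambda>U. f ` U) \<Gamma> \<Gamma>"
  using assms Bij_imp_funcset[OF grading_aut_Bij[OF assms]]
  by (auto simp: grading_aut_def lie_automorphisms_def)

lemma compose_image: "U \<in> \<Gamma> \<Longrightarrow> compose L f g ` U = f ` g ` U"
  using component_sub by (force simp: compose_def image_image)

lemma grading_aut_compose:
  assumes f: "f \<in> grading_aut L \<Gamma>" and g: "g \<in> grading_aut L \<Gamma>"
  shows "compose L f g \<in> grading_aut L \<Gamma>"
proof -
  have "bij_betw ((\<lambda>U. f ` U) \<circ> (\<lambda>U. g ` U)) \<Gamma> \<Gamma>"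
    using grading_aut_D(5)[OF g] grading_aut_D(5)[OF f] by (rule bij_betw_trans)
  then have "bij_betw (\<lambda>U. compose L f g ` U) \<Gamma> \<Gamma>"
    by (subst bij_betw_cong[of \<Gamma> _ "(\<lambda>U. f ` U) \<circ> (\<lambda>U. g ` U)"]) (simp_all add: compose_image)
  moreover have "compose L f g \<in> Bij L" using f g by (intro compose_Bij grading_aut_Bij)
  ultimately show ?thesis
    using grading_aut_D[OF f] grading_aut_D[OF g] add_closed smult_closed bracket_closed
    by (simp add: grading_aut_def lie_automorphisms_def compose_eq)
qed

lemma grading_aut_id: "(\<lambda>X\<in>L. X) \<in> grading_aut L \<Gamma>"
proof -
  have "(\<lambda>X\<in>L. X) ` U = U" if "U \<in> \<Gamma>" for U
    using component_sub[OF that] by (force simp: image_def)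
  then have "bij_betw (\<lambda>U. (\<lambda>X\<in>L. X) ` U) \<Gamma> \<Gamma>"
    by (subst bij_betw_cong[of \<Gamma> _ "\<lambda>U. U"]) (simp_all add: bij_betw_def)
  moreover have "(\<lambda>X\<in>L. X) \<in> lie_automorphisms L"
    using add_closed smult_closed bracket_closed by (simp add: lie_automorphisms_def id_Bij)
  ultimately show ?thesis unfolding grading_aut_def by blast
qed

lemma grading_aut_inverse:
  assumes f: "f \<in> grading_aut L \<Gamma>"
  shows "(\<lambda>X\<in>L. inv_into L f X) \<in> grading_aut L \<Gamma>"
proof -
  let ?g = "\<lambda>X\<in>L. inv_into L f X"
  have bij: "bij_betw f L L" using grading_aut_Bij[OF f] by (simp add: Bij_def)
  have gf: "?g (f X) = X" if "X \<in> L" for X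
    using that grading_aut_D(1)[OF f] bij_betw_inv_into_left[OF bij] by simp
  have fg: "?g X \<in> L \<and> f (?g X) = X" if "X \<in> L" for X
    using that bij_betw_inv_into_right[OF bij] bij_betwE[OF bij_betw_inv_into[OF bij]] by simp
  have img: "?g ` f ` U = U" "f ` U \<in> \<Gamma>" if "U \<in> \<Gamma>" for U
  proof -
    have "?g (f X) = X" if "X \<in> U" for X using component_sub[OF \<open>U \<in> \<Gamma>\<close>] that by (intro gf) auto
    then show "?g ` f ` U = U" by (force simp: image_image simp del: restrict_apply)
    show "f ` U \<in> \<Gamma>" using bij_betwE[OF grading_aut_D(5)[OF f]] that by blast
  qed
  have surj: "\<exists>V\<in>\<Gamma>. U = f ` V" if "U \<in> \<Gamma>" for U
    using bij_betw_imp_surj_on[OF grading_aut_D(5)[OF f]] that by blast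
  have "bij_betw (\<lambda>U. ?g ` U) \<Gamma> \<Gamma>"
  proof (rule bij_betwI[of _ _ _ "\<lambda>U. f ` U"])
    show "(\<lambda>U. ?g ` U) \<in> \<Gamma> \<rightarrow> \<Gamma>" using surj img by (metis (no_types, lifting) Pi_I)
    show "(\<lambda>U. f ` U) \<in> \<Gamma> \<rightarrow> \<Gamma>" using img by blast
    show "f ` ?g ` U = U" if "U \<in> \<Gamma>" for U using surj[OF that] img by metis
    show "?g ` f ` U = U" if "U \<in> \<Gamma>" for U using img that by blast
  qed
  moreover have "?g (X + Y) = ?g X + ?g Y" if "X \<in> L" "Y \<in> L" for X Y
    using gf[of "?g X + ?g Y"] grading_aut_D(2)[OF f] fg add_closed that by metis
  moreover have "?g (c \<cdot>\<^sub>m X) = c \<cdot>\<^sub>m ?g X" if "X \<in> L" for c X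
    using gf[of "c \<cdot>\<^sub>m ?g X"] grading_aut_D(3)[OF f] fg smult_closed that by metis
  moreover have "?g (lie_bracket X Y) = lie_bracket (?g X) (?g Y)" if "X \<in> L" "Y \<in> L" for X Y
    using gf[of "lie_bracket (?g X) (?g Y)"] grading_aut_D(4)[OF f] fg bracket_closed that by metis
  moreover have "?g \<in> Bij L" using grading_aut_Bij[OF f] by (rule restrict_inv_into_Bij)
  ultimately show ?thesis unfolding grading_aut_def lie_automorphisms_def by blast
qed

lemma subgroup_grading_aut: "subgroup (grading_aut L \<Gamma>) (BijGroup L)"
proof (rule subgroup.intro)
  show "grading_aut L \<Gamma> \<subseteq> carrier (BijGroup L)"
    using grading_aut_Bij by (auto simp: BijGroup_def)
  show "f \<otimes>\<^bsub>BijGroup L\<^esub> g \<in> grading_aut L \<Gamma>" if "f \<in> grading_aut L \<Gamma>" "g \<in> grading_aut L \<Gamma>" for f g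
    using that grading_aut_Bij by (simp add: BijGroup_def grading_aut_compose)
  show "\<one>\<^bsub>BijGroup L\<^esub> \<in> grading_aut L \<Gamma>" by (simp add: BijGroup_def grading_aut_id)
  show "inv\<^bsub>BijGroup L\<^esub> f \<in> grading_aut L \<Gamma>" if "f \<in> grading_aut L \<Gamma>" for f
    using inv_BijGroup[OF grading_aut_Bij[OF that]] grading_aut_inverse[OF that] by simp
qed

section \<open>The Weyl group as a group of permutations of the components\<close>

definition component_action :: "('a mat \<Rightarrow> 'a mat) \<Rightarrow> 'a mat set \<Rightarrow> 'a mat set" where
  "component_action f = (\<lambda>U\<in>\<Gamma>. f ` U)"

lemma component_action_Bij: "f \<in> grading_aut L \<Gamma> \<Longrightarrow> component_action f \<in> Bij \<Gamma>"
  using grading_aut_D(5) by (simp add: Bij_def component_action_def)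

lemma component_action_compose:
  assumes f: "f \<in> grading_aut L \<Gamma>" and g: "g \<in> grading_aut L \<Gamma>"
  shows "component_action (compose L f g) = compose \<Gamma> (component_action f) (component_action g)"
proof (rule extensionalityI[of _ \<Gamma>])
  fix U assume U: "U \<in> \<Gamma>"
  then have "g ` U \<in> \<Gamma>" using bij_betwE[OF grading_aut_D(5)[OF g]] by blast
  with U show "component_action (compose L f g) U = compose \<Gamma> (component_action f) (component_action g) U"
    by (simp add: component_action_def compose_eq compose_image)
qed (simp_all add: component_action_def)

abbreviation "image_group \<equiv> BijGroup \<Gamma>\<lparr>carrier := component_action ` grading_aut L \<Gamma>\<rparr>"

text \<open>First isomorphism theorem: the kernel of the action on components is the stabilizer of
  the grading.\<close>

lemma weyl_group_iso: "weyl_group L \<Gamma> \<cong> image_group"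
proof -
  let ?A = "BijGroup L\<lparr>carrier := grading_aut L \<Gamma>\<rparr>"
  have A: "group ?A" using subgroup_grading_aut group_BijGroup by (rule subgroup.subgroup_is_group)
  have hom: "component_action f \<otimes>\<^bsub>BijGroup \<Gamma>\<^esub> component_action g = component_action (f \<otimes>\<^bsub>?A\<^esub> g)"
    if "f \<in> grading_aut L \<Gamma>" "g \<in> grading_aut L \<Gamma>" for f g
    using that component_action_Bij grading_aut_Bij
    by (simp add: BijGroup_def component_action_compose)
  \<comment> \<open>The target is first the group of all permutations of \<Gamma>, which makes the
    image a subgroup; afterwards the map is read as a homomorphism onto that image.\<close>
  interpret full: group_hom ?A "BijGroup \<Gamma>" component_action
    using A group_BijGroup component_action_Bij
    by (intro group_hom.intro group_hom_axioms.intro homI) (simp_all add: hom BijGroup_def[of \<Gamma>, THEN arg_cong[of _ _ carrier]])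
  have img: "subgroup (component_action ` grading_aut L \<Gamma>) (BijGroup \<Gamma>)"
    using full.img_is_subgroup by simp
  interpret group_hom ?A image_group component_action
    using A subgroup.subgroup_is_group[OF img group_BijGroup]
    by (intro group_hom.intro group_hom_axioms.intro homI) (simp_all add: hom)
  have "kernel ?A image_group component_action = grading_stab L \<Gamma>"
  proof -
    have "component_action f = (\<lambda>U\<in>\<Gamma>. U) \<longleftrightarrow> (\<forall>U\<in>\<Gamma>. f ` U = U)" for f
      unfolding component_action_def by (metis restrict_apply restrict_ext)
    \<comment> \<open>An automorphism that maps each component to itself in particular permutes the
      components, so the stabilizer lies in \<open>grading_aut L \<Gamma>\<close>.\<close>
    moreover have "bij_betw (\<lambda>U. f ` U) \<Gamma> \<Gamma>" if "\<forall>U\<in>\<Gamma>. f ` U = U" for f :: "'a mat \<Rightarrow> 'a mat"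
      using that by (subst bij_betw_cong[of \<Gamma> _ "\<lambda>U. U"]) (simp_all add: bij_betw_def)
    ultimately show ?thesis
      by (auto simp: kernel_def grading_stab_def grading_aut_def BijGroup_def)
  qed
  then show ?thesis
    using FactGroup_iso unfolding weyl_group_def by simp
qed

end

section \<open>Degrees of the matrix units\<close>

lemma (in subgroup) rcos_eq_iff:
  assumes "group G" "x \<in> carrier G" "y \<in> carrier G"
  shows "H #> x = H #> y \<longleftrightarrow> x \<otimes> inv y \<in> H"
proof -
  interpret group G by fact
  have "H #> x = H #> y \<longleftrightarrow> x \<in> H #> y"
    using assms repr_independence[of x H y] repr_independenceD[of H x y] rcos_self[of x H] subgroup_axioms
    by blast
  then show ?thesis using assms rcos_module by simp
qed

text \<open>The parity of n enters as \<open>0 < q\<close>, which provides a fixed point of the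
  involution.\<close>

locale B_indices =
  fixes q s :: nat
  assumes q_pos: "0 < q" and n_ge5: "5 \<le> q + 2 * s"
begin

abbreviation "n \<equiv> q + 2 * s"
abbreviation "d \<equiv> B_dual q"

end

sublocale B_indices \<subseteq> involution_pairs n d
proof
  show "5 \<le> n" by (rule n_ge5)
  show "\<exists>i<n. d i = i" using q_pos by (intro exI[of _ 0]) (simp add: B_dual_fixed)
qed (simp_all add: B_dual_less B_dual_dual)

context B_indices
begin

lemma dual_eq_self_iff: "d i = i \<longleftrightarrow> i < q"
  by (auto simp: B_dual_def elim: oddE evenE)

abbreviation "free_B \<equiv> free_Abelian_group {0..<n}"

text \<open>One formula for both kinds of words lets the relations be treated through the involution
  alone.\<close>

lemma B_words_iff: "u \<in> B_words q s \<longleftrightarrow> (\<exists>i<n. u = frag_of i + frag_of (d i))"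
proof
  assume "u \<in> B_words q s"
  then show "\<exists>i<n. u = frag_of i + frag_of (d i)"
    unfolding B_words_def
  proof
    assume "u \<in> {frag_of i + frag_of i |i. i < q}"
    then obtain i where "i < q" "u = frag_of i + frag_of i" by blast
    then show ?thesis by (intro exI[of _ i]) (auto simp: B_dual_fixed)
  next
    assume "u \<in> {frag_of (q + 2 * k) + frag_of (q + 2 * k + 1) |k. k < s}"
    then obtain k where "k < s" "u = frag_of (q + 2 * k) + frag_of (q + 2 * k + 1)" by blast
    then show ?thesis by (intro exI[of _ "q + 2 * k"]) (auto simp: B_dual_def)
  qed
next
  assume "\<exists>i<n. u = frag_of i + frag_of (d i)"
  then obtain i where i: "i < n" "u = frag_of i + frag_of (d i)" by blast
  show "u \<in> B_words q s"
  proof (cases "i < q")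
    case True
    then show ?thesis using i by (auto simp: B_words_def B_dual_fixed)
  next
    case False
    then obtain k where k: "i = q + k" by (metis le_Suc_ex not_less)
    have "u = frag_of (q + 2 * (k div 2)) + frag_of (q + 2 * (k div 2) + 1)"
      using i k by (cases "even k") (auto simp: B_dual_def add.commute elim!: evenE oddE)
    moreover have "k div 2 < s" using i k by auto
    ultimately show ?thesis unfolding B_words_def by blast
  qed
qed

lemma B_relations_generators:
  "{u - v | u v. u \<in> B_words q s \<and> v \<in> B_words q s} \<subseteq> carrier free_B"
proof -
  have "Poly_Mapping.keys u \<subseteq> {0..<n}" if u: "u \<in> B_words q s" for u
  proof -
    obtain i where i: "i < n" "u = frag_of i + frag_of (d i)" using u unfolding B_words_iff by blast
    have "Poly_Mapping.keys u \<subseteq> {i} \<union> {d i}"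
      unfolding i(2) using keys_add[of "frag_of i" "frag_of (d i)"] by (simp only: keys_frag_of)
    then show ?thesis using i(1) by auto
  qed
  then have "Poly_Mapping.keys (u - v) \<subseteq> {0..<n}" if "u \<in> B_words q s" "v \<in> B_words q s" for u v
    using keys_diff[of u v] that by blast
  then show ?thesis unfolding subset_iff carrier_free_Abelian_group_iff by blast
qed

lemma B_relations_normal: "B_relations q s \<lhd> free_B"
  unfolding B_relations_def
  using comm_group.normal_iff_subgroup[OF abelian_free_Abelian_group]
    group.generate_is_subgroup[OF group_free_Abelian_group B_relations_generators] by blast

text \<open>Each word has both properties, and they survive sums and negatives. They serve as the
  invariants that tell degrees apart.\<close>

lemma B_relations_lookup:
  assumes "x \<in> B_relations q s"
  shows "Poly_Mapping.lookup x (d k) = Poly_Mapping.lookup x k"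
    and "d k = k \<Longrightarrow> even (Poly_Mapping.lookup x k)"
proof -
  let ?P = "\<lambda>x. Poly_Mapping.lookup x (d k) = Poly_Mapping.lookup x k \<and>
    (d k = k \<longrightarrow> even (Poly_Mapping.lookup x k))"
  have W: "?P (u - v)" if uv: "u \<in> B_words q s" "v \<in> B_words q s" for u v
  proof -
    have "?P u" if "u \<in> B_words q s" for u
      using that d_eq_iff d_d unfolding B_words_iff by (auto simp: lookup_add)
    from this[OF uv(1)] this[OF uv(2)] show ?thesis by (auto simp: lookup_minus)
  qed
  have "?P x"
    using assms unfolding B_relations_def
  proof (induction rule: generate.induct)
    case (inv h)
    then have "h \<in> carrier free_B" using B_relations_generators by blast
    then have "inv\<^bsub>free_B\<^esub> h = - h" by simp
    with inv W show ?case by auto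
  qed (use W in \<open>auto simp: lookup_add\<close>)
  then show "Poly_Mapping.lookup x (d k) = Poly_Mapping.lookup x k"
    and "d k = k \<Longrightarrow> even (Poly_Mapping.lookup x k)" by blast+
qed

lemma keys_frag_diff: "i < n \<Longrightarrow> j < n \<Longrightarrow> Poly_Mapping.keys (frag_of i - frag_of j) \<subseteq> {0..<n}"
  using keys_diff[of "frag_of i" "frag_of j"] by (auto simp: keys_frag_of)

lemma B_deg_coset:
  assumes "i < n" "j < n"
  shows "B_deg q s i j = B_relations q s #>\<^bsub>free_B\<^esub> (frag_of i - frag_of j)"
proof -
  interpret N: normal "B_relations q s" free_B by (rule B_relations_normal)
  have "B_gen q s j \<in> carrier (free_B Mod B_relations q s)"
    using assms by (auto simp: B_gen_def carrier_FactGroup)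
  then show ?thesis
    using assms
    by (simp add: B_deg_def B_big_group_def N.inv_FactGroup) (simp add: B_gen_def N.rcos_inv N.rcos_sum)
qed

text \<open>The involution sends \<open>E\<^sub>i\<^sub>j\<close> to the matrix unit at
  \<open>(d j, d i)\<close>, which has the same degree; otherwise degrees coincide only on the
  diagonal. Any further coincidence would make x a relation with an unbalanced or odd
  coefficient.\<close>

lemma B_deg_eq_iff:
  assumes ij: "i < n" "j < n" and kl: "k < n" "l < n"
  shows "B_deg q s i j = B_deg q s k l \<longleftrightarrow> (k = i \<and> l = j) \<or> (k = d j \<and> l = d i) \<or> (i = j \<and> k = l)"
    (is "_ \<longleftrightarrow> ?R")
proof -
  interpret N: normal "B_relations q s" free_B by (rule B_relations_normal)
  define x where "x = frag_of i - frag_of j - (frag_of k - frag_of l)"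
  have "B_deg q s i j = B_deg q s k l \<longleftrightarrow>
      (frag_of i - frag_of j) \<otimes>\<^bsub>free_B\<^esub> inv\<^bsub>free_B\<^esub> (frag_of k - frag_of l) \<in> B_relations q s"
    unfolding B_deg_coset[OF ij] B_deg_coset[OF kl]
    using keys_frag_diff ij kl by (intro N.rcos_eq_iff N.is_group) auto
  also have "\<dots> \<longleftrightarrow> x \<in> B_relations q s"
    using keys_frag_diff[OF kl] by (simp add: x_def algebra_simps)
  also have "\<dots> \<longleftrightarrow> ?R"
  proof
    assume x: "x \<in> B_relations q s"
    have lk: "Poly_Mapping.lookup x t = (if t = i then 1 else 0) - (if t = j then 1 else 0)
        - (if t = k then 1 else 0) + (if t = l then 1 else 0)" for t
      by (simp add: x_def lookup_minus)
    have sym: "Poly_Mapping.lookup x (d t) = Poly_Mapping.lookup x t" for t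
      using B_relations_lookup[OF x] by blast
    have ev: "Poly_Mapping.lookup x t = 1 \<Longrightarrow> d t \<noteq> t" "Poly_Mapping.lookup x t = - 1 \<Longrightarrow> d t \<noteq> t" for t
      using B_relations_lookup(2)[OF x, of t] by auto
    show ?R
    proof (cases "i = j \<or> k = l \<or> i = k \<or> j = l")
      case True
      \<comment> \<open>After a cancellation x is a difference of two generators. If they differ,
        the coefficient 1 at a forces a to be moved and has no counterpart at
        \<open>d a\<close>.\<close>
      have red: "a = b" if "\<And>t. Poly_Mapping.lookup x t = (if t = a then 1 else 0) - (if t = b then 1 else 0)" for a b
        using sym[of a] ev(1)[of a] by (auto simp: that split: if_splits)
      from True consider "i = j" | "k = l" | "i = k" | "j = l" by blast
      then show ?thesis
      proof cases
        case 1 then show ?thesis using red[of l k] by (auto simp: lk)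
      next
        case 2 then show ?thesis using red[of i j] by (auto simp: lk)
      next
        case 3 then show ?thesis using red[of l j] by (auto simp: lk)
      next
        case 4 then show ?thesis using red[of i k] by (auto simp: lk)
      qed
    next
      case False
      \<comment> \<open>Positive contributions occur at i and l only. The coefficient at i must be
        repeated at \<open>d i\<close>, and it cannot be 1 at a fixed point.\<close>
      have "l = d i"
        using False sym[of i] ev(1)[of i] by (auto simp: lk split: if_splits)
      moreover have "k = d j"
        using False sym[of j] ev(2)[of j] by (auto simp: lk split: if_splits)
      ultimately show ?thesis by blast
    qed
  next
    assume ?R
    then consider "x = 0" | "k = d j" "l = d i" by (auto simp: x_def)
    then show "x \<in> B_relations q s"
    proof cases
      case 1
      then show ?thesis using subgroup.one_closed[OF N.subgroup_axioms] by simp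
    next
      case 2
      then have "x = (frag_of i + frag_of (d i)) - (frag_of j + frag_of (d j))" by (simp add: x_def)
      moreover have "frag_of i + frag_of (d i) \<in> B_words q s" "frag_of j + frag_of (d j) \<in> B_words q s"
        using ij unfolding B_words_iff by blast+
      ultimately show ?thesis unfolding B_relations_def by (intro generate.incl) blast
    qed
  qed
  finally show ?thesis .
qed

lemma B_group_iff_B_deg: "i < n \<Longrightarrow> j < n \<Longrightarrow> B_deg q s i j \<in> B_group q s"
  unfolding B_group_def by (intro generate.incl) blast

end

section \<open>Signed permutations as a centralizer\<close>

context B_indices
begin

text \<open>The member b (0 or 1) of the k-th pair, where k starts at 1 to agree with
  \<open>sym_group s\<close>.\<close>

definition pt :: "nat \<Rightarrow> nat \<Rightarrow> nat" where
  "pt k b = q + 2 * (k - 1) + b"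

text \<open>The shift by one below q occurs because \<open>sym_group q\<close> acts on
  \<open>{1..q}\<close>. The bit is read at the target pair: this fits the product in
  \<open>wreath_Z2_Sym\<close>, where the second bit vector is precomposed with
  \<open>inv' \<tau>\<close>.\<close>

definition index_perm :: "(nat \<Rightarrow> nat) \<times> (nat \<Rightarrow> int) \<times> (nat \<Rightarrow> nat) \<Rightarrow> nat \<Rightarrow> nat" where
  "index_perm = (\<lambda>(\<sigma>, a, \<tau>) i.
     if i < q then \<sigma> (i + 1) - 1
     else if i < n then pt (\<tau> ((i - q) div 2 + 1)) ((i - q + nat (a (\<tau> ((i - q) div 2 + 1)))) mod 2)
     else i)"

abbreviation "model \<equiv> sym_group q \<times>\<times> wreath_Z2_Sym s"

lemma model_carrier: "(\<sigma>, a, \<tau>) \<in> carrier model \<longleftrightarrow>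
    \<sigma> permutes {1..q} \<and> a \<in> {1..s} \<rightarrow>\<^sub>E {0..<2} \<and> \<tau> permutes {1..s}"
  by (auto simp: DirProd_def wreath_Z2_Sym_def semidirect_product_def sym_group_def carrier_integer_mod_group)

lemma model_mult: "(\<sigma>, a, \<tau>) \<otimes>\<^bsub>model\<^esub> (\<sigma>', a', \<tau>') =
    (\<sigma> \<circ> \<sigma>', (\<lambda>i\<in>{1..s}. (a i + a' (inv' \<tau> i)) mod 2), \<tau> \<circ> \<tau>')"
  by (auto simp: DirProd_def wreath_Z2_Sym_def semidirect_product_def sym_group_def product_group_def
      cong: restrict_cong)

lemma bit_cases: "a \<in> {1..s} \<rightarrow>\<^sub>E {0..<2::int} \<Longrightarrow> k \<in> {1..s} \<Longrightarrow> a k \<in> {0, 1}"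
  by (drule (1) PiE_mem) auto

lemma model_closed:
  assumes "x \<in> carrier model" "y \<in> carrier model" shows "x \<otimes>\<^bsub>model\<^esub> y \<in> carrier model"
proof -
  obtain \<sigma> a \<tau> where x: "x = (\<sigma>, a, \<tau>)" by (cases x)
  obtain \<sigma>' a' \<tau>' where y: "y = (\<sigma>', a', \<tau>')" by (cases y)
  show ?thesis using assms unfolding x y model_mult model_carrier by (auto intro: permutes_compose)
qed

lemma pt_bounds: "k \<in> {1..s} \<Longrightarrow> b < 2 \<Longrightarrow> q \<le> pt k b \<and> pt k b < n"
  by (auto simp: pt_def)

lemma pt_eq_iff:
  assumes "k \<in> {1..s}" "b < 2" "k' \<in> {1..s}" "b' < 2"
  shows "pt k b = pt k' b' \<longleftrightarrow> k = k' \<and> b = b'"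
  using assms by (auto simp: pt_def) presburger+

lemma pt_cases:
  assumes "q \<le> i" "i < n" obtains k b where "k \<in> {1..s}" "b < 2" "i = pt k b"
proof
  show "(i - q) div 2 + 1 \<in> {1..s}" "(i - q) mod 2 < 2" using assms by auto
  show "i = pt ((i - q) div 2 + 1) ((i - q) mod 2)" using assms by (simp add: pt_def)
qed

lemma dual_pt: "k \<in> {1..s} \<Longrightarrow> b < 2 \<Longrightarrow> d (pt k b) = pt k (1 - b)"
  by (auto simp: pt_def B_dual_def less_2_cases_iff)

lemma index_perm_fixed: "i < q \<Longrightarrow> index_perm (\<sigma>, a, \<tau>) i = \<sigma> (i + 1) - 1"
  by (simp add: index_perm_def)

lemma index_perm_pt:
  assumes "k \<in> {1..s}" "b < 2"
  shows "index_perm (\<sigma>, a, \<tau>) (pt k b) = pt (\<tau> k) ((b + nat (a (\<tau> k))) mod 2)"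
proof -
  have "(pt k b - q) div 2 + 1 = k" using assms by (simp add: pt_def)
  moreover have "(pt k b - q + nat z) mod 2 = (b + nat z) mod 2" for z
    using mod_mult_self2[of "b + nat z" 2 "k - 1"] by (simp add: pt_def ac_simps)
  ultimately show ?thesis using pt_bounds[OF assms] by (simp add: index_perm_def)
qed

lemma index_perm_outside: "\<not> i < n \<Longrightarrow> index_perm x i = i"
  by (cases x) (simp add: index_perm_def)

lemma index_cases:
  obtains "i < q" | k b where "k \<in> {1..s}" "b < 2" "i = pt k b" | "\<not> i < n"
  using pt_cases[of i] by (metis not_le)

lemma sym_less: "\<sigma> permutes {1..q} \<Longrightarrow> i < q \<Longrightarrow> 1 \<le> \<sigma> (i + 1) \<and> \<sigma> (i + 1) \<le> q"
  using permutes_in_image[of \<sigma> "{1..q}" "i + 1"] by auto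

lemma index_perm_mult:
  assumes x: "x \<in> carrier model" and y: "y \<in> carrier model"
  shows "index_perm (x \<otimes>\<^bsub>model\<^esub> y) = index_perm x \<circ> index_perm y"
proof
  obtain \<sigma> a \<tau> where x': "x = (\<sigma>, a, \<tau>)" by (cases x)
  obtain \<sigma>' a' \<tau>' where y': "y = (\<sigma>', a', \<tau>')" by (cases y)
  have X: "\<sigma> permutes {1..q}" "\<tau> permutes {1..s}" "a \<in> {1..s} \<rightarrow>\<^sub>E {0..<2}"
    using x unfolding x' model_carrier by auto
  note a = bit_cases[OF X(3)]
  have Y: "\<sigma>' permutes {1..q}" "\<tau>' permutes {1..s}" "a' \<in> {1..s} \<rightarrow>\<^sub>E {0..<2}"
    using y unfolding y' model_carrier by auto
  note a' = bit_cases[OF Y(3)]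
  fix i
  show "index_perm (x \<otimes>\<^bsub>model\<^esub> y) i = (index_perm x \<circ> index_perm y) i"
  proof (cases i rule: index_cases)
    case 1
    have "\<sigma>' (i + 1) - 1 < q" "\<sigma>' (i + 1) - 1 + 1 = \<sigma>' (i + 1)" using sym_less[OF Y(1) 1] by auto
    with 1 show ?thesis unfolding x' y' model_mult by (simp add: index_perm_fixed)
  next
    case (2 k b)
    have k': "\<tau>' k \<in> {1..s}" using permutes_in_image[OF Y(2)] 2 by blast
    have k'': "\<tau> (\<tau>' k) \<in> {1..s}" using permutes_in_image[OF X(2)] k' by blast
    have inv: "inv' \<tau> (\<tau> (\<tau>' k)) = \<tau>' k" using permutes_inverses(2)[OF X(2)] by simp
    have "(b + nat ((a (\<tau> (\<tau>' k)) + a' (\<tau>' k)) mod 2)) mod 2 =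
        ((b + nat (a' (\<tau>' k))) mod 2 + nat (a (\<tau> (\<tau>' k)))) mod 2"
      using a[OF k''] a'[OF k'] 2(2) by (auto simp: less_2_cases_iff)
    then show ?thesis
      using 2 k' k'' inv unfolding x' y' model_mult by (simp add: index_perm_pt del: One_nat_def)
  qed (simp add: index_perm_outside)
qed

text \<open>Indices below q stay there and pairs are carried to pairs, so injectivity can be checked
  separately on the two kinds of indices.\<close>

lemma index_perm_centralizer:
  assumes x: "x \<in> carrier model" shows "index_perm x \<in> centralizer"
proof -
  obtain \<sigma> a \<tau> where x': "x = (\<sigma>, a, \<tau>)" by (cases x)
  have X: "\<sigma> permutes {1..q}" "\<tau> permutes {1..s}" "a \<in> {1..s} \<rightarrow>\<^sub>E {0..<2}"
    using x unfolding x' model_carrier by auto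
  note a = bit_cases[OF X(3)]
  have \<tau>: "\<tau> k \<in> {1..s}" if "k \<in> {1..s}" for k using permutes_in_image[OF X(2)] that by blast
  have fx: "index_perm x i = \<sigma> (i + 1) - 1" "index_perm x i < q" if "i < q" for i
    using sym_less[OF X(1) that] that by (auto simp: x' index_perm_fixed)
  have mv: "index_perm x (pt k b) = pt (\<tau> k) ((b + nat (a (\<tau> k))) mod 2)" "q \<le> index_perm x (pt k b)"
    "index_perm x (pt k b) < n" if "k \<in> {1..s}" "b < 2" for k b
    using that \<tau>[OF that(1)] pt_bounds[of "\<tau> k"] by (simp_all add: x' index_perm_pt)
  have sub: "index_perm x ` {..<n} \<subseteq> {..<n}"
  proof clarify
    fix i assume "i < n"
    then show "index_perm x i < n" by (cases i rule: index_cases) (use fx mv in force)+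
  qed
  have inj: "i = j" if eq: "index_perm x i = index_perm x j" and "i < n" "j < n" for i j
  proof (cases "i < q")
    case True
    have "j < q"
    proof (rule ccontr)
      assume "\<not> j < q"
      then obtain k b where "k \<in> {1..s}" "b < 2" "j = pt k b" using pt_cases[of j] \<open>j < n\<close> by (metis not_le)
      then show False using fx(2)[OF True] mv eq by (metis not_le)
    qed
    then have "\<sigma> (i + 1) = \<sigma> (j + 1)" using sym_less[OF X(1) True] sym_less[OF X(1), of j] fx True eq by auto
    then show ?thesis using permutes_inj[OF X(1)] by (auto dest: injD)
  next
    case False
    then obtain k b where kb: "k \<in> {1..s}" "b < 2" "i = pt k b" using pt_cases[of i] \<open>i < n\<close> by (metis not_le)
    have "\<not> j < q" using fx(2)[of j] mv[OF kb(1,2)] eq kb(3) by auto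
    then obtain k' b' where kb': "k' \<in> {1..s}" "b' < 2" "j = pt k' b'" using pt_cases[of j] \<open>j < n\<close> by (metis not_le)
    have "pt (\<tau> k) ((b + nat (a (\<tau> k))) mod 2) = pt (\<tau> k') ((b' + nat (a (\<tau> k'))) mod 2)"
      using eq mv(1)[OF kb(1,2)] mv(1)[OF kb'(1,2)] kb(3) kb'(3) by simp
    then have *: "\<tau> k = \<tau> k' \<and> (b + nat (a (\<tau> k))) mod 2 = (b' + nat (a (\<tau> k'))) mod 2"
      by (rule pt_eq_iff[THEN iffD1, rotated 4]) (use \<tau>[OF kb(1)] \<tau>[OF kb'(1)] in simp_all)
    then have "k = k'" using permutes_inj[OF X(2)] by (auto dest: injD)
    moreover have "b = b'" using * a[OF \<tau>[OF kb(1)]] kb(2) kb'(2) by (auto simp: less_2_cases_iff)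
    ultimately show ?thesis using kb kb' by simp
  qed
  have "bij_betw (index_perm x) {..<n} {..<n}"
    using sub inj by (simp add: bij_betw_def inj_on_def endo_inj_surj)
  then have "index_perm x permutes {..<n}"
    by (rule bij_imp_permutes) (simp add: index_perm_outside)
  moreover have "index_perm x (d i) = d (index_perm x i)" if "i < n" for i
  proof (cases i rule: index_cases)
    case 1
    then show ?thesis using fx by (simp add: B_dual_fixed)
  next
    case (2 k b)
    \<comment> \<open>The involution complements the bit within a pair, and complementing commutes
      with adding \<open>a (\<tau> k)\<close> modulo 2.\<close>
    have "(1 - b + nat (a (\<tau> k))) mod 2 = 1 - (b + nat (a (\<tau> k))) mod 2"
      using a[OF \<tau>[OF 2(1)]] 2(2) by (auto simp: less_2_cases_iff)
    then show ?thesis using 2 \<tau>[OF 2(1)] by (simp add: dual_pt mv(1))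
  qed (use that in simp)
  ultimately show ?thesis by (simp add: centralizer_def)
qed

lemma index_perm_inj: "inj_on index_perm (carrier model)"
proof (rule inj_onI)
  fix x y assume xy: "x \<in> carrier model" "y \<in> carrier model" and eq: "index_perm x = index_perm y"
  obtain \<sigma> a \<tau> where x': "x = (\<sigma>, a, \<tau>)" by (cases x)
  obtain \<sigma>' a' \<tau>' where y': "y = (\<sigma>', a', \<tau>')" by (cases y)
  have X: "\<sigma> permutes {1..q}" "\<tau> permutes {1..s}" "a \<in> {1..s} \<rightarrow>\<^sub>E {0..<2}"
    using xy unfolding x' model_carrier by auto
  have Y: "\<sigma>' permutes {1..q}" "\<tau>' permutes {1..s}" "a' \<in> {1..s} \<rightarrow>\<^sub>E {0..<2}"
    using xy unfolding y' model_carrier by auto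
  have "\<sigma> i = \<sigma>' i" for i
  proof (cases "i \<in> {1..q}")
    case True
    then have i: "i - 1 < q" "i - 1 + 1 = i" by auto
    show ?thesis
      using fun_cong[OF eq, of "i - 1"] sym_less[OF X(1) i(1)] sym_less[OF Y(1) i(1)] i
      unfolding x' y' index_perm_fixed[OF i(1)] i(2) by linarith
  next
    case False
    then show ?thesis using permutes_not_in[OF X(1)] permutes_not_in[OF Y(1)] by simp
  qed
  moreover have \<tau>: "\<tau> k = \<tau>' k \<and> (k \<in> {1..s} \<longrightarrow> a (\<tau> k) = a' (\<tau> k))" for k
  proof (cases "k \<in> {1..s}")
    case True
    have t: "\<tau> k \<in> {1..s}" "\<tau>' k \<in> {1..s}"
      using permutes_in_image[OF X(2)] permutes_in_image[OF Y(2)] True by blast+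
    have "pt (\<tau> k) (nat (a (\<tau> k)) mod 2) = pt (\<tau>' k) (nat (a' (\<tau>' k)) mod 2)"
      using fun_cong[OF eq, of "pt k 0"] True unfolding x' y' by (simp add: index_perm_pt)
    then have "\<tau> k = \<tau>' k \<and> nat (a (\<tau> k)) mod 2 = nat (a' (\<tau>' k)) mod 2"
      using t by (subst (asm) pt_eq_iff) auto
    moreover have "a (\<tau> k) \<in> {0..<2}" "a' (\<tau>' k) \<in> {0..<2}"
      using t X(3) Y(3) by (auto simp: PiE_iff)
    ultimately show ?thesis by (auto simp: nat_eq_iff split: if_splits)
  next
    case False
    then show ?thesis using permutes_not_in[OF X(2) False] permutes_not_in[OF Y(2) False] by auto
  qed
  moreover have "a = a'"
  proof (rule PiE_ext[OF X(3) Y(3)])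
    \<comment> \<open>The bits were compared at the indices \<open>\<tau> k\<close>, and these
      exhaust \<open>{1..s}\<close>.\<close>
    fix m assume "m \<in> {1..s}"
    then have "m = \<tau> (inv' \<tau> m)" "inv' \<tau> m \<in> {1..s}"
      using permutes_inverses(1)[OF X(2)] permutes_in_image[OF permutes_inv[OF X(2)]] by simp_all
    then show "a m = a' m" using \<tau> by metis
  qed
  ultimately show "x = y" unfolding x' y' by auto
qed

text \<open>The fixed points of \<open>d\<close> are the indices below q, so \<pi> preserves them
  and permutes the pairs. All three components of the preimage are read off the fixed points and the
  first members \<open>pt k 0\<close>.\<close>

lemma index_perm_surj:
  assumes \<pi>: "\<pi> \<in> centralizer" shows "\<exists>x\<in>carrier model. index_perm x = \<pi>"
proof -
  have perm: "\<pi> permutes {..<n}" and comm: "\<And>i. i < n \<Longrightarrow> \<pi> (d i) = d (\<pi> i)"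
    using \<pi> by (auto simp: centralizer_def)
  have inj: "\<pi> i = \<pi> j \<longleftrightarrow> i = j" for i j using permutes_inj[OF perm] by (auto dest: injD)
  have less: "\<pi> i < n" if "i < n" for i using permutes_in_image[OF perm] that by blast
  have fx: "\<pi> i < q \<longleftrightarrow> i < q" if "i < n" for i
    using comm[OF that] inj dual_eq_self_iff by metis
  define \<sigma> where "\<sigma> j = (if j \<in> {1..q} then \<pi> (j - 1) + 1 else j)" for j
  define \<tau> where "\<tau> k = (if k \<in> {1..s} then (\<pi> (pt k 0) - q) div 2 + 1 else k)" for k
  \<comment> \<open>Bits belong to target pairs, so the source of the pair m is recovered by
    \<open>inv' \<tau>\<close>.\<close>
  define a where "a = (\<lambda>m\<in>{1..s}. int ((\<pi> (pt (inv' \<tau> m) 0) - q) mod 2))"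
  have "inj_on \<sigma> {1..q}" by (auto simp: inj_on_def \<sigma>_def inj)
  moreover have "\<sigma> ` {1..q} \<subseteq> {1..q}"
  proof clarify
    fix j
    assume j: "j \<in> {1..q}"
    then have "j - 1 < q" "j - 1 < n" by auto
    then have "\<pi> (j - 1) < q" using fx by blast
    then show "\<sigma> j \<in> {1..q}" using j by (simp add: \<sigma>_def)
  qed
  ultimately have "bij_betw \<sigma> {1..q} {1..q}" by (simp add: bij_betw_def endo_inj_surj)
  then have \<sigma>: "\<sigma> permutes {1..q}" by (rule bij_imp_permutes) (auto simp: \<sigma>_def)
  have pt0: "\<tau> k \<in> {1..s} \<and> \<pi> (pt k 0) = pt (\<tau> k) ((\<pi> (pt k 0) - q) mod 2)" if k: "k \<in> {1..s}" for k
  proof -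
    have "q \<le> \<pi> (pt k 0)" "\<pi> (pt k 0) < n"
      using fx[of "pt k 0"] less[of "pt k 0"] pt_bounds[OF k, of 0] by auto
    then show ?thesis using k by (auto simp: \<tau>_def pt_def)
  qed
  have "inj_on \<tau> {1..s}"
  proof (rule inj_onI)
    fix k k' assume k: "k \<in> {1..s}" "k' \<in> {1..s}" "\<tau> k = \<tau> k'"
    let ?b = "(\<pi> (pt k 0) - q) mod 2" and ?b' = "(\<pi> (pt k' 0) - q) mod 2"
    have e: "\<pi> (pt k 0) = pt (\<tau> k) ?b" "\<pi> (pt k' 0) = pt (\<tau> k) ?b'" using pt0[OF k(1)] pt0[OF k(2)] k(3) by simp_all
    have t: "\<tau> k \<in> {1..s}" using pt0 k by blast
    have lt: "?b < 2" "?b' < 2" by simp_all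
    then have "?b = ?b' \<or> ?b' = 1 - ?b" by linarith
    \<comment> \<open>Two points of one image pair are equal or dual, and the dual of
      \<open>\<pi> (pt k 0)\<close> is the image of the other member of pair k.\<close>
    then have "\<pi> (pt k' 0) = \<pi> (pt k 0) \<or> \<pi> (pt k' 0) = d (\<pi> (pt k 0))"
      using e dual_pt[OF t lt(1)] by metis
    moreover have "d (\<pi> (pt k 0)) = \<pi> (pt k 1)"
      using comm[of "pt k 0"] pt_bounds[OF k(1), of 0] dual_pt[OF k(1), of 0] by simp
    ultimately have "pt k' 0 = pt k 0 \<or> pt k' 0 = pt k 1" by (simp only: inj)
    then show "k = k'" using pt_eq_iff k by auto
  qed
  moreover have "\<tau> ` {1..s} \<subseteq> {1..s}" using pt0 by blast
  ultimately have "bij_betw \<tau> {1..s} {1..s}" by (simp add: bij_betw_def endo_inj_surj)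
  then have \<tau>: "\<tau> permutes {1..s}" by (rule bij_imp_permutes) (auto simp: \<tau>_def)
  have a: "a \<in> {1..s} \<rightarrow>\<^sub>E {0..<2}" by (auto simp: a_def)
  have a\<tau>: "nat (a (\<tau> k)) = (\<pi> (pt k 0) - q) mod 2" if "k \<in> {1..s}" for k
    using that pt0[OF that] permutes_inverses(2)[OF \<tau>] by (simp add: a_def)
  have "index_perm (\<sigma>, a, \<tau>) i = \<pi> i" for i
  proof (cases i rule: index_cases)
    case 1
    then show ?thesis by (simp add: index_perm_fixed \<sigma>_def)
  next
    case (2 k b)
    note t = pt0[OF 2(1)]
    show ?thesis
    proof (cases "b = 0")
      case True
      then show ?thesis using 2 t a\<tau>[OF 2(1)] by (simp add: index_perm_pt)
    next
      case False
      then have b: "b = 1" using 2 by simp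
      \<comment> \<open>The second member is the dual of the first, so commutation with
        \<open>d\<close> determines its image.\<close>
      have "i = d (pt k 0)" using 2 b by (simp add: dual_pt)
      then have "\<pi> i = d (\<pi> (pt k 0))" using comm pt_bounds[OF 2(1), of 0] by simp
      also have "\<dots> = d (pt (\<tau> k) ((\<pi> (pt k 0) - q) mod 2))" using t by simp
      also have "\<dots> = pt (\<tau> k) (1 - (\<pi> (pt k 0) - q) mod 2)" using t by (intro dual_pt) auto
      also have "1 - (\<pi> (pt k 0) - q) mod 2 = (b + nat (a (\<tau> k))) mod 2"
        unfolding a\<tau>[OF 2(1)] b
        using mod_less_divisor[of 2 "\<pi> (pt k 0) - q"] by (auto simp: less_2_cases_iff)
      finally show ?thesis using 2 by (simp add: index_perm_pt)
    qed
  next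
    case 3
    then show ?thesis using permutes_not_in[OF perm, of i] by (simp add: index_perm_outside)
  qed
  moreover have "(\<sigma>, a, \<tau>) \<in> carrier model" unfolding model_carrier using \<sigma> \<tau> a by blast
  ultimately show ?thesis by blast
qed

end

section \<open>The components and their brackets\<close>

text \<open>The parameter \<open>ty\<close> fixes the field; the hypothesis on the characteristic
  takes the form 2 \<noteq> 0.\<close>

locale B_algebra = B_indices +
  fixes ty :: "'a::field itself"
  assumes two: "(2::'a) \<noteq> 0"
begin

abbreviation L :: "'a mat set" where "L \<equiv> so_algebra q s"
abbreviation \<Gamma> :: "'a mat set set" where "\<Gamma> \<equiv> Gamma_B q s"
abbreviation Z :: "'a mat" where "Z \<equiv> 0\<^sub>m n n"

lemma bij_dual: "bij_betw d {0..<n} {0..<n}"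
  by (rule bij_betwI[of _ _ _ d]) auto

text \<open>The form is the permutation matrix of \<open>d\<close>, so the involution puts the entry
  at \<open>(d j, d i)\<close> into position \<open>(i, j)\<close>.\<close>

lemma L_iff: "X \<in> L \<longleftrightarrow> X \<in> carrier_mat n n \<and> (\<forall>i<n. \<forall>j<n. X $$ (i, j) = - X $$ (d j, d i))"
proof (cases "X \<in> carrier_mat n n")
  case X: True
  define Y where "Y = transpose_mat X"
  have Y: "Y \<in> carrier_mat n n" using X by (simp add: Y_def)
  have FY: "B_form q s * Y = mat n n (\<lambda>(i, j). Y $$ (d i, j))"
    using Y by (intro eq_matI)
      (auto simp: B_form_eq scalar_prod_def if_distrib[of "\<lambda>x. x * _"] cong: if_cong)
  have delta: "(\<Sum>t\<in>{0..<n}. if j = d t then f t else 0) = f (d j)" if "j < n" for j and f :: "nat \<Rightarrow> 'a"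
  proof -
    have "(j = d t) = (t = d j)" for t by auto
    then have "(\<Sum>t\<in>{0..<n}. if j = d t then f t else 0) = (\<Sum>t\<in>{0..<n}. if t = d j then f t else 0)"
      by (simp only:)
    then show ?thesis using that by simp
  qed
  have "B_involution q s X = mat n n (\<lambda>(i, j). X $$ (d j, d i))"
    unfolding B_involution_def B_form_inverse option.sel Y_def[symmetric] FY
    by (intro eq_matI) (use X in \<open>auto simp: B_form_eq scalar_prod_def Y_def delta
      if_distrib[of "\<lambda>x. _ * x"] cong: if_cong\<close>)
  then have "X \<in> L \<longleftrightarrow> mat n n (\<lambda>(i, j). X $$ (d j, d i)) = - X"
    using X by (simp add: so_algebra_def)
  also have "\<dots> \<longleftrightarrow> (\<forall>i<n. \<forall>j<n. X $$ (d j, d i) = - X $$ (i, j))"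
    using X by (auto simp: mat_eq_iff)
  finally show ?thesis using X by (metis minus_minus)
qed (simp add: so_algebra_def)

lemma L_carrier: "X \<in> L \<Longrightarrow> X \<in> carrier_mat n n"
  by (simp add: L_iff)

lemma L_dim [simp]: "X \<in> L \<Longrightarrow> dim_row X = n" "X \<in> L \<Longrightarrow> dim_col X = n"
  by (auto dest: L_carrier)

lemma L_skew: "X \<in> L \<Longrightarrow> i < n \<Longrightarrow> j < n \<Longrightarrow> X $$ (d j, d i) = - X $$ (i, j)"
  unfolding L_iff by (metis minus_minus)

text \<open>The position \<open>(i, d i)\<close> is its own mirror image, so the entry is its own
  negative; here the characteristic enters.\<close>

lemma L_antidiagonal: "X \<in> L \<Longrightarrow> i < n \<Longrightarrow> X $$ (i, d i) = 0"
proof -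
  assume "X \<in> L" "i < n"
  then have "X $$ (i, d i) = - X $$ (i, d i)" using L_skew[of X i "d i"] by simp
  then have "2 * X $$ (i, d i) = 0" unfolding mult_2 by (metis add.right_inverse)
  with two show ?thesis by simp
qed

lemma zero_L: "Z \<in> L" by (simp add: L_iff)

lemma add_L: "X \<in> L \<Longrightarrow> Y \<in> L \<Longrightarrow> X + Y \<in> L"
  unfolding L_iff[of "X + Y"] by (auto simp: L_skew L_carrier)

lemma smult_L: "X \<in> L \<Longrightarrow> c \<cdot>\<^sub>m X \<in> L"
  unfolding L_iff[of "c \<cdot>\<^sub>m X"] by (auto simp: L_skew L_carrier)

lemma mult_index:
  assumes "A \<in> carrier_mat n n" "B \<in> carrier_mat n n" "i < n" "j < n"
  shows "(A * B) $$ (i, j) = (\<Sum>t\<in>{0..<n}. A $$ (i, t) * B $$ (t, j))"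
  using assms by (simp add: scalar_prod_def)

lemma bracket_index:
  assumes "A \<in> carrier_mat n n" "B \<in> carrier_mat n n" "i < n" "j < n"
  shows "lie_bracket A B $$ (i, j) = (A * B) $$ (i, j) - (B * A) $$ (i, j)"
  using assms by (simp add: lie_bracket_def)

lemma bracket_carrier:
  "A \<in> carrier_mat n n \<Longrightarrow> B \<in> carrier_mat n n \<Longrightarrow> lie_bracket A B \<in> carrier_mat n n"
  by (auto simp: lie_bracket_def)

text \<open>The involution reverses products. For two skew factors the signs cancel, so it
  interchanges XY and YX and negates their difference.\<close>

lemma bracket_L: assumes X: "X \<in> L" and Y: "Y \<in> L" shows "lie_bracket X Y \<in> L"
proof -
  note c = L_carrier[OF X] L_carrier[OF Y]
  have *: "(A * B) $$ (d j, d i) = (B * A) $$ (i, j)" if "A \<in> L" "B \<in> L" "i < n" "j < n" for A B :: "'a mat" and i j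
  proof -
    have "(A * B) $$ (d j, d i) = (\<Sum>t\<in>{0..<n}. A $$ (d j, t) * B $$ (t, d i))"
      using that by (intro mult_index L_carrier) auto
    also have "\<dots> = (\<Sum>t\<in>{0..<n}. A $$ (d j, d t) * B $$ (d t, d i))"
      by (rule sum.reindex_bij_betw[OF bij_dual, symmetric])
    also have "\<dots> = (\<Sum>t\<in>{0..<n}. B $$ (i, t) * A $$ (t, j))"
      using that by (intro sum.cong) (simp_all add: L_skew)
    also have "\<dots> = (B * A) $$ (i, j)"
      using that by (intro mult_index[symmetric] L_carrier) auto
    finally show ?thesis .
  qed
  show ?thesis
    unfolding L_iff using bracket_carrier[OF c] c X Y by (auto simp: bracket_index * simp del: index_mult_mat)
qed

lemma bracket_smult:
  assumes "A \<in> carrier_mat n n" "B \<in> carrier_mat n n"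
  shows "lie_bracket (a \<cdot>\<^sub>m A) (b \<cdot>\<^sub>m B) = (a * b) \<cdot>\<^sub>m lie_bracket A B"
  by (rule eq_matI)
    (use assms in \<open>auto simp: lie_bracket_def scalar_prod_def sum_distrib_left right_diff_distrib mult_ac\<close>)

section \<open>Wedge matrices and the components of the grading\<close>

definition wedge :: "nat \<Rightarrow> nat \<Rightarrow> 'a mat" where
  "wedge i j = mat n n (\<lambda>(k, l). of_bool (k = i \<and> l = d j) - of_bool (k = j \<and> l = d i))"

text \<open>Described by supports, as the homogeneous components are; for a pair of indices it is
  one-dimensional by \<open>line_multiple\<close>.\<close>

definition line :: "nat set \<Rightarrow> 'a mat set" where
  "line u = {X \<in> L. \<forall>k<n. \<forall>l<n. X $$ (k, l) \<noteq> 0 \<longrightarrow> {k, d l} = u}"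

definition diag :: "'a mat set" where
  "diag = {X \<in> L. \<forall>k<n. \<forall>l<n. X $$ (k, l) \<noteq> 0 \<longrightarrow> k = l}"

text \<open>Contains \<open>diag\<close> even if s = 0, when it is zero and not a component, so that
  statements on brackets hold uniformly.\<close>

definition comps :: "'a mat set set" where
  "comps = insert diag (line ` pairs)"

lemma lineD: "X \<in> line u \<Longrightarrow> k < n \<Longrightarrow> l < n \<Longrightarrow> X $$ (k, l) \<noteq> 0 \<Longrightarrow> {k, d l} = u"
  by (simp add: line_def)

lemma diagD: "X \<in> diag \<Longrightarrow> k < n \<Longrightarrow> l < n \<Longrightarrow> X $$ (k, l) \<noteq> 0 \<Longrightarrow> k = l"
  by (simp add: diag_def)

lemma wedge_carrier: "wedge i j \<in> carrier_mat n n"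
  by (simp add: wedge_def)

lemma wedge_index: "k < n \<Longrightarrow> l < n \<Longrightarrow>
  wedge i j $$ (k, l) = of_bool (k = i \<and> l = d j) - of_bool (k = j \<and> l = d i)"
  by (simp add: wedge_def)

lemma wedge_L: "wedge i j \<in> L"
proof -
  have *: "d l = a \<and> d k = d b \<longleftrightarrow> k = b \<and> l = d a" for k l a b by auto
  have "wedge i j $$ (k, l) = - wedge i j $$ (d l, d k)" if "k < n" "l < n" for k l
    using that by (simp only: wedge_index d_less_iff * minus_diff_eq)
  then show ?thesis unfolding L_iff using wedge_carrier by blast
qed

lemma wedge_self: "wedge i i = Z"
  by (rule eq_matI) (auto simp: wedge_def)

lemma wedge_line: "wedge i j \<in> line {i, j}"
  by (auto simp: line_def wedge_L wedge_index)

lemma wedge_diag: "wedge i (d i) \<in> diag"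
  by (auto simp: diag_def wedge_L wedge_index)

lemma wedge_nonzero: assumes "i < n" "j < n" "i \<noteq> j" shows "wedge i j \<noteq> Z"
proof
  assume "wedge i j = Z"
  moreover have "wedge i j $$ (i, d j) = 1" using assms by (simp add: wedge_index)
  ultimately show False using assms by simp
qed

text \<open>The support condition leaves two positions, and skewness makes their entries negatives
  of each other.\<close>

lemma line_multiple:
  assumes "apart i j" "X \<in> line {i, j}"
  shows "X = X $$ (i, d j) \<cdot>\<^sub>m wedge i j"
proof (rule eq_matI)
  note ij = apart_neq[OF assms(1)]
  have X: "X \<in> L" and sup: "\<And>k l. k < n \<Longrightarrow> l < n \<Longrightarrow> X $$ (k, l) \<noteq> 0 \<Longrightarrow> {k, d l} = {i, j}"
    using assms by (auto simp: line_def)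
  fix k l assume "k < dim_row (X $$ (i, d j) \<cdot>\<^sub>m wedge i j)" "l < dim_col (X $$ (i, d j) \<cdot>\<^sub>m wedge i j)"
  then have kl: "k < n" "l < n" by (simp_all add: wedge_def)
  have "X $$ (j, d i) = - X $$ (i, d j)" using L_skew[OF X, of i "d j"] ij by simp
  moreover have "X $$ (k, l) = 0" if "\<not> (k = i \<and> l = d j)" "\<not> (k = j \<and> l = d i)"
  proof (rule ccontr)
    assume "X $$ (k, l) \<noteq> 0"
    from sup[OF kl this] that show False by (auto simp: doubleton_eq_iff)
  qed
  ultimately show "X $$ (k, l) = (X $$ (i, d j) \<cdot>\<^sub>m wedge i j) $$ (k, l)"
    using kl ij carrier_matD[OF wedge_carrier[of i j]] by (auto simp: wedge_index)
qed (use assms carrier_matD[OF wedge_carrier[of i j]] in \<open>auto simp: line_def\<close>)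

lemma comps_sub: "U \<in> comps \<Longrightarrow> U \<subseteq> L"
  by (auto simp: comps_def line_def diag_def)

lemma comps_smult: "U \<in> comps \<Longrightarrow> X \<in> U \<Longrightarrow> c \<cdot>\<^sub>m X \<in> U"
proof -
  assume "U \<in> comps" "X \<in> U"
  moreover have "c \<cdot>\<^sub>m X \<in> line u" if "X \<in> line u" for u
    using that by (simp add: line_def smult_L)
  moreover have "c \<cdot>\<^sub>m X \<in> diag" if "X \<in> diag"
    using that by (simp add: diag_def smult_L)
  ultimately show "c \<cdot>\<^sub>m X \<in> U" by (auto simp: comps_def)
qed

lemma nonzero_index: "X \<in> L \<Longrightarrow> X \<noteq> Z \<Longrightarrow> \<exists>k<n. \<exists>l<n. X $$ (k, l) \<noteq> 0"
  by (auto simp: mat_eq_iff)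

text \<open>A single nonzero entry at \<open>(k, l)\<close> already determines the component:
  \<open>diag\<close> if k = l, otherwise the line of \<open>{k, d l}\<close>.\<close>

lemma comps_inter:
  assumes "U \<in> comps" "V \<in> comps" "X \<in> U" "X \<in> V" "X \<noteq> Z"
  shows "U = V"
proof -
  obtain k l where kl: "k < n" "l < n" "X $$ (k, l) \<noteq> 0"
    using assms comps_sub nonzero_index by blast
  have "W = (if k = l then diag else line {k, d l})" if "W \<in> comps" "X \<in> W" for W
  proof -
    from that(1) consider "W = diag" | u where "u \<in> pairs" "W = line u" by (auto simp: comps_def)
    then show ?thesis
    proof cases
      case 1
      then have "k = l" using that(2) kl by (simp add: diag_def)
      with 1 show ?thesis by simp
    next
      case 2
      then have u: "{k, d l} = u" using that(2) kl by (simp add: line_def)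
      then have "k \<noteq> l" using 2(1) apart_neq(1)[of k l] by auto
      with u 2(2) show ?thesis by simp
    qed
  qed
  with assms show ?thesis by metis
qed

lemma line_inj: "u \<in> pairs \<Longrightarrow> v \<in> pairs \<Longrightarrow> line u = line v \<Longrightarrow> u = v"
proof -
  assume u: "u \<in> pairs" and "line u = line v"
  obtain i j where ij: "u = {i, j}" "apart i j" using u by (rule pairsE)
  have "wedge i j \<in> line v" "wedge i j $$ (i, d j) = 1"
    using ij(1) wedge_line[of i j] \<open>line u = line v\<close> apart_neq[OF ij(2)] by (simp_all add: wedge_index)
  then show "u = v" using ij(1) apart_neq[OF ij(2)] lineD[of "wedge i j" v i "d j"] by simp
qed

lemma line_ne_diag: "u \<in> pairs \<Longrightarrow> line u \<noteq> diag"
proof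
  assume u: "u \<in> pairs" and "line u = diag"
  obtain i j where ij: "u = {i, j}" "apart i j" using u by (rule pairsE)
  have "wedge i j \<in> diag" "wedge i j $$ (i, d j) = 1"
    using ij(1) wedge_line[of i j] \<open>line u = diag\<close> apart_neq[OF ij(2)] by (simp_all add: wedge_index)
  then show False using apart_neq[OF ij(2)] diagD[of "wedge i j" i "d j"] by simp
qed

text \<open>Without swapped pairs, every diagonal position has the form \<open>(i, d i)\<close>,
  where skew matrices vanish.\<close>

lemma diag_trivial: "s = 0 \<Longrightarrow> diag = {Z}"
proof -
  assume s: "s = 0"
  have "X = Z" if "X \<in> diag" for X
  proof (rule ccontr)
    assume "X \<noteq> Z"
    moreover have X: "X \<in> L" using that by (simp add: diag_def)
    ultimately obtain k l where kl: "k < n" "l < n" "X $$ (k, l) \<noteq> 0" using nonzero_index by blast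
    then have "k = l" using that diagD by blast
    then have "l = d k" using kl(1) s dual_eq_self_iff[of k] by simp
    then show False using L_antidiagonal[OF X kl(1)] kl(3) by simp
  qed
  then show ?thesis using zero_L by (auto simp: diag_def)
qed

text \<open>A nonzero component has a nonzero entry at some \<open>(k, l)\<close>, whose degree is
  that of the component; \<open>B_deg_eq_iff\<close> then gives all positions of this
  degree.\<close>

lemma Gamma_eq: "\<Gamma> = line ` pairs \<union> (if s = 0 then {} else {diag})"
proof -
  have RL: "R_component q s g \<inter> L = {X \<in> L. \<forall>i<n. \<forall>j<n. X $$ (i, j) \<noteq> 0 \<longrightarrow> B_deg q s i j = g}" for g
    using L_carrier unfolding R_component_eq by blast
  have line: "R_component q s (B_deg q s i (d j)) \<inter> L = line {i, j}" if ij: "apart i j" for i j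
  proof -
    have "B_deg q s k l = B_deg q s i (d j) \<longleftrightarrow> {k, d l} = {i, j}" if "k < n" "l < n" for k l
      using that apart_neq[OF ij] by (subst B_deg_eq_iff) (auto simp: doubleton_eq_iff)
    then show ?thesis unfolding RL line_def by blast
  qed
  have diag: "R_component q s (B_deg q s i i) \<inter> L = diag" if i: "i < n" for i
  proof -
    have "B_deg q s k l = B_deg q s i i \<longleftrightarrow> k = l" if "k < n" "l < n" for k l
      using that i by (subst B_deg_eq_iff) auto
    then show ?thesis unfolding RL diag_def by blast
  qed
  show ?thesis
  proof (intro equalityI subsetI)
    fix U assume "U \<in> \<Gamma>"
    then obtain g where g: "U = R_component q s g \<inter> L" "U \<noteq> {Z}" by (auto simp: Gamma_B_def)
    have "Z \<in> U" unfolding g RL using zero_L by simp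
    then obtain X where X: "X \<in> U" "X \<noteq> Z" using g(2) by blast
    then have XL: "X \<in> L" using g(1) by blast
    obtain k l where kl: "k < n" "l < n" "X $$ (k, l) \<noteq> 0" using nonzero_index[OF XL X(2)] by blast
    have deg: "g = B_deg q s k l" using X(1) kl unfolding g RL by auto
    \<comment> \<open>This excludes k = \<open>d l\<close>, so off the diagonal k and
      \<open>d l\<close> are apart.\<close>
    have ne: "l \<noteq> d k" using L_antidiagonal[OF XL kl(1)] kl(3) by auto
    show "U \<in> line ` pairs \<union> (if s = 0 then {} else {diag})"
    proof (cases "k = l")
      case True
      then have "U = diag" using diag kl deg g by simp
      then show ?thesis using diag_trivial g(2) by auto
    next
      case False
      then have "apart k (d l)" using kl ne unfolding apart_def by auto
      then show ?thesis using line[of k "d l"] deg g by auto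
    qed
  next
    fix U assume "U \<in> line ` pairs \<union> (if s = 0 then {} else {diag})"
    then consider u where "u \<in> pairs" "U = line u" | "s \<noteq> 0" "U = diag"
      by (auto split: if_splits)
    then show "U \<in> \<Gamma>"
    proof cases
      case 1
      obtain i j where u: "u = {i, j}" "apart i j" using 1(1) by (rule pairsE)
      note ij = apart_neq[OF u(2)]
      have "U \<noteq> {Z}" using 1 u(1) wedge_line[of i j] wedge_nonzero[OF ij(4,5,1)] by auto
      moreover have "B_deg q s i (d j) \<in> B_group q s" using ij by (intro B_group_iff_B_deg) auto
      ultimately show ?thesis unfolding Gamma_B_def using line[OF u(2)] 1(2) u(1) by blast
    next
      case 2
      \<comment> \<open>The index q is the first member of the first swapped pair, so
        \<open>wedge q (d q)\<close> is a nonzero diagonal element.\<close>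
      then have q: "q < n" "d q \<noteq> q" by (simp_all add: dual_eq_self_iff)
      have "U \<noteq> {Z}" using 2 wedge_diag[of q] wedge_nonzero[of q "d q"] q by auto
      moreover have "B_deg q s q q \<in> B_group q s" using q by (intro B_group_iff_B_deg) auto
      ultimately show ?thesis unfolding Gamma_B_def using diag[OF q(1)] 2(2) by blast
    qed
  qed
qed

lemma Gamma_comps: "\<Gamma> \<subseteq> comps"
  by (auto simp: Gamma_eq comps_def)

section \<open>Brackets of wedge matrices and of diagonal matrices\<close>

lemma wedge_mult_index:
  assumes "i < n" "j < n" "B \<in> carrier_mat n n" "r < n" "c < n"
  shows "(wedge i j * B) $$ (r, c) = of_bool (r = i) * B $$ (d j, c) - of_bool (r = j) * B $$ (d i, c)"
proof -
  have "(wedge i j * B) $$ (r, c) = (\<Sum>t\<in>{0..<n}. wedge i j $$ (r, t) * B $$ (t, c))"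
    using assms by (intro mult_index wedge_carrier)
  also have "\<dots> = (\<Sum>t\<in>{0..<n}. (if t = d j then of_bool (r = i) * B $$ (t, c) else 0)
      - (if t = d i then of_bool (r = j) * B $$ (t, c) else 0))"
    using assms by (intro sum.cong) (auto simp: wedge_index algebra_simps)
  also have "\<dots> = of_bool (r = i) * B $$ (d j, c) - of_bool (r = j) * B $$ (d i, c)"
    using assms by (simp add: sum_subtractf)
  finally show ?thesis .
qed

text \<open>The bracket of an orthogonal Lie algebra on the exterior square, with
  \<open>of_bool (k = d j)\<close> as the value of the bilinear form on \<open>e\<^sub>j\<close> and
  \<open>e\<^sub>k\<close>.\<close>

lemma bracket_wedge:
  assumes "i < n" "j < n" "k < n" "l < n"
  shows "lie_bracket (wedge i j) (wedge k l) =
    of_bool (k = d j) \<cdot>\<^sub>m wedge i l - of_bool (l = d j) \<cdot>\<^sub>m wedge i k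
    - of_bool (k = d i) \<cdot>\<^sub>m wedge j l + of_bool (l = d i) \<cdot>\<^sub>m wedge j k"
    (is "_ = ?R")
proof (rule eq_matI)
  have dims: "dim_row (wedge a b) = n" "dim_col (wedge a b) = n" for a b by (simp_all add: wedge_def)
  show "dim_row (lie_bracket (wedge i j) (wedge k l)) = dim_row ?R"
    "dim_col (lie_bracket (wedge i j) (wedge k l)) = dim_col ?R"
    by (simp_all add: lie_bracket_def dims)
  fix r c assume "r < dim_row ?R" "c < dim_col ?R"
  then have rc: "r < n" "c < n" by (simp_all add: dims)
  have conj: "of_bool (P \<and> Q) = (of_bool P * of_bool Q :: 'a)" for P Q by simp
  \<comment> \<open>Once all index equations are oriented alike, both sides are the same polynomial
    in the indicators.\<close>
  have sw: "d j = k \<longleftrightarrow> k = d j" "d j = l \<longleftrightarrow> l = d j" "d i = k \<longleftrightarrow> k = d i" "d i = l \<longleftrightarrow> l = d i"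
    "d l = i \<longleftrightarrow> l = d i" "d l = j \<longleftrightarrow> l = d j" "d k = i \<longleftrightarrow> k = d i" "d k = j \<longleftrightarrow> k = d j" by auto
  have "lie_bracket (wedge i j) (wedge k l) $$ (r, c) =
     (of_bool (r = i) * wedge k l $$ (d j, c) - of_bool (r = j) * wedge k l $$ (d i, c))
     - (of_bool (r = k) * wedge i j $$ (d l, c) - of_bool (r = l) * wedge i j $$ (d k, c))"
    using assms rc by (simp only: bracket_index wedge_carrier wedge_mult_index)
  also have "\<dots> = of_bool (k = d j) * wedge i l $$ (r, c) - of_bool (l = d j) * wedge i k $$ (r, c)
      - of_bool (k = d i) * wedge j l $$ (r, c) + of_bool (l = d i) * wedge j k $$ (r, c)"
    using assms rc by (simp only: wedge_index d_less_iff conj sw) (simp add: algebra_simps del: of_bool_eq_iff)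
  also have "\<dots> = ?R $$ (r, c)"
    using rc by (simp add: dims)
  finally show "lie_bracket (wedge i j) (wedge k l) $$ (r, c) = ?R $$ (r, c)" .
qed

lemma diag_mult_index:
  assumes D: "D \<in> diag" and "B \<in> carrier_mat n n" "r < n" "c < n"
  shows "(D * B) $$ (r, c) = D $$ (r, r) * B $$ (r, c)" "(B * D) $$ (r, c) = B $$ (r, c) * D $$ (c, c)"
proof -
  have D': "D \<in> carrier_mat n n" using D L_carrier by (auto simp: diag_def)
  have off: "D $$ (k, l) = 0" if "k < n" "l < n" "k \<noteq> l" for k l using diagD[OF D] that by blast
  have "(D * B) $$ (r, c) = (\<Sum>t\<in>{0..<n}. if t = r then D $$ (r, t) * B $$ (t, c) else 0)"
    unfolding mult_index[OF D' assms(2-)] using assms off[of r] by (intro sum.cong) auto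
  then show "(D * B) $$ (r, c) = D $$ (r, r) * B $$ (r, c)" using assms by simp
  have "(B * D) $$ (r, c) = (\<Sum>t\<in>{0..<n}. if t = c then B $$ (r, t) * D $$ (t, c) else 0)"
    unfolding mult_index[OF assms(2) D' assms(3-)] using assms off[of _ c] by (intro sum.cong) auto
  then show "(B * D) $$ (r, c) = B $$ (r, c) * D $$ (c, c)" using assms by simp
qed

lemma add_diag: assumes X: "X \<in> diag" and Y: "Y \<in> diag" shows "X + Y \<in> diag"
proof -
  have "X \<in> L" "Y \<in> L" using X Y by (simp_all add: diag_def)
  moreover have "X $$ (k, l) = 0" "Y $$ (k, l) = 0" if "k < n" "l < n" "k \<noteq> l" for k l
    using diagD[OF X] diagD[OF Y] that by blast+
  ultimately show ?thesis unfolding diag_def using add_L by fastforce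
qed

text \<open>Bracketing with a diagonal matrix rescales each entry, so the support can only
  shrink.\<close>

lemma bracket_diag:
  assumes D: "D \<in> diag" and V: "V \<in> comps" "X \<in> V"
  shows "lie_bracket D X \<in> V"
proof -
  have DL: "D \<in> L" using D by (simp add: diag_def)
  have XL: "X \<in> L" using V comps_sub by blast
  have B: "lie_bracket D X \<in> L" by (rule bracket_L[OF DL XL])
  have "lie_bracket D X $$ (r, c) = (D $$ (r, r) - D $$ (c, c)) * X $$ (r, c)" if "r < n" "c < n" for r c
    using that by (simp only: bracket_index L_carrier[OF DL] L_carrier[OF XL] diag_mult_index[OF D]) (simp add: algebra_simps)
  then have nz: "X $$ (r, c) \<noteq> 0" if "r < n" "c < n" "lie_bracket D X $$ (r, c) \<noteq> 0" for r c
    using that by auto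
  from V(1) consider "V = diag" | u where "V = line u" by (auto simp: comps_def)
  then show ?thesis
  proof cases
    case 1 then show ?thesis using B nz V(2) diagD unfolding diag_def by blast
  next
    case 2 then show ?thesis using B nz V(2) lineD unfolding line_def by blast
  qed
qed

section \<open>The relation on components given by nonzero brackets\<close>

definition meets :: "'a mat set \<Rightarrow> 'a mat set \<Rightarrow> 'a mat set \<Rightarrow> bool" where
  "meets U V T \<longleftrightarrow> (\<exists>X\<in>U. \<exists>Y\<in>V. lie_bracket X Y \<in> T \<and> lie_bracket X Y \<noteq> Z)"

text \<open>Both lines are spanned by their wedge matrices, so a single bracket decides; scaling it
  by a nonzero factor does not leave T.\<close>

lemma meets_line_iff:
  assumes ij: "apart i j" and kl: "apart k l" and T: "T \<in> comps"
  shows "meets (line {i, j}) (line {k, l}) T \<longleftrightarrow>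
    lie_bracket (wedge i j) (wedge k l) \<in> T \<and> lie_bracket (wedge i j) (wedge k l) \<noteq> Z" (is "?L \<longleftrightarrow> ?R")
proof
  assume ?R then show ?L unfolding meets_def using wedge_line by blast
next
  let ?B = "lie_bracket (wedge i j) (wedge k l)"
  assume ?L
  then obtain X Y where X: "X \<in> line {i, j}" and Y: "Y \<in> line {k, l}" and
    B: "lie_bracket X Y \<in> T" "lie_bracket X Y \<noteq> Z" by (auto simp: meets_def)
  obtain a b where "X = a \<cdot>\<^sub>m wedge i j" "Y = b \<cdot>\<^sub>m wedge k l"
    using line_multiple[OF ij X] line_multiple[OF kl Y] by blast
  then have eq: "lie_bracket X Y = (a * b) \<cdot>\<^sub>m ?B" by (simp add: bracket_smult wedge_carrier)
  have c: "?B \<in> carrier_mat n n" by (intro bracket_carrier wedge_carrier)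
  have "?B \<noteq> Z" using B(2) eq by auto
  moreover have "a * b \<noteq> 0"
  proof
    assume "a * b = 0"
    then have "lie_bracket X Y = Z" unfolding eq using c by (intro eq_matI) auto
    with B(2) show False by blast
  qed
  then have "?B = (1 / (a * b)) \<cdot>\<^sub>m lie_bracket X Y" unfolding eq using c by (intro eq_matI) auto
  then have "?B \<in> T" using comps_smult[OF T B(1)] by metis
  ultimately show ?R by blast
qed

lemma smult_of_bool: "A \<in> carrier_mat n n \<Longrightarrow> of_bool P \<cdot>\<^sub>m A = (if P then A else Z)"
  by (rule eq_matI) auto

lemma bracket_wedge_if:
  assumes "i < n" "j < n" "k < n" "l < n"
  shows "lie_bracket (wedge i j) (wedge k l) =
    (if k = d j then wedge i l else Z) - (if l = d j then wedge i k else Z)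
    - (if k = d i then wedge j l else Z) + (if l = d i then wedge j k else Z)"
  using bracket_wedge[OF assms] by (simp only: smult_of_bool wedge_carrier)

lemma minus_zero: "A \<in> carrier_mat n n \<Longrightarrow> A - Z = A"
  by (intro eq_matI) auto

text \<open>Being apart kills two of the four terms. The last one survives only for l =
  \<open>d i\<close>, and then the whole bracket is diagonal.\<close>

lemma bracket_wedge_chain:
  assumes "apart i j" "apart j l"
  shows "lie_bracket (wedge i j) (wedge (d j) l) = wedge i l + (if l = d i then wedge j (d j) else Z)"
proof -
  have "l \<noteq> d j" "d j \<noteq> d i" "i < n" "j < n" "l < n"
    using apart_neq[OF assms(1)] apart_neq[OF assms(2)] by auto
  then show ?thesis
    using wedge_carrier[of i l] wedge_carrier[of j "d j"] by (simp add: bracket_wedge_if minus_zero)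
qed

lemma meets_brel:
  assumes "brel u v w" shows "meets (line u) (line v) (line w)"
proof -
  obtain i j l where *: "apart i j" "apart j l" "apart i l" "u = {i, j}" "v = {d j, l}" "w = {i, l}"
    using assms unfolding brel_def by blast
  have "lie_bracket (wedge i j) (wedge (d j) l) = wedge i l"
    using bracket_wedge_chain[OF *(1,2)] apart_neq[OF *(3)] wedge_carrier[of i l] by simp
  then have "lie_bracket (wedge i j) (wedge (d j) l) \<in> line w \<and> lie_bracket (wedge i j) (wedge (d j) l) \<noteq> Z"
    using wedge_line[of i l] wedge_nonzero[of i l] apart_neq[OF *(3)] *(6) by simp
  then show ?thesis unfolding meets_def *(4,5) using wedge_line by blast
qed

text \<open>A nonzero bracket needs some j in u with \<open>d j\<close> in v. With i and l the
  remaining members it is diagonal for l = \<open>d i\<close>, zero for l = i \<noteq>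
  \<open>d i\<close>, and otherwise spans the line of \<open>{i, l}\<close>.\<close>

lemma meets_cases:
  assumes u: "u \<in> pairs" and v: "v \<in> pairs" and T: "T \<in> comps" and m: "meets (line u) (line v) T"
  shows "(\<exists>w\<in>pairs. brel u v w \<and> T = line w) \<or> (T = diag \<and> v = d ` u \<and> d ` u \<noteq> u)"
proof -
  have "\<exists>j\<in>u. d j \<in> v"
  proof (rule ccontr)
    assume none: "\<not> ?thesis"
    obtain i j where ij: "u = {i, j}" "apart i j" using u by (rule pairsE)
    obtain k l where kl: "v = {k, l}" "apart k l" using v by (rule pairsE)
    have "lie_bracket (wedge i j) (wedge k l) = Z"
    proof -
      have "k \<noteq> d j" "l \<noteq> d j" "k \<noteq> d i" "l \<noteq> d i" using none ij(1) kl(1) by auto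
      then show ?thesis
        using apart_neq[OF ij(2)] apart_neq[OF kl(2)] by (simp add: bracket_wedge_if minus_zero)
    qed
    then show False using m meets_line_iff[OF ij(2) kl(2) T] ij kl by simp
  qed
  then obtain j where j: "j \<in> u" "d j \<in> v" by blast
  obtain i where i: "u = {j, i}" "apart j i" using u j(1) by (rule pairs_memE)
  obtain l where l: "v = {d j, l}" "apart (d j) l" using v j(2) by (rule pairs_memE)
  have ij: "u = {i, j}" "apart i j" "apart j l" using i l by (auto simp: apart_sym)
  note ne = apart_neq[OF ij(2)] apart_neq[OF ij(3)]
  define B where "B = lie_bracket (wedge i j) (wedge (d j) l)"
  have B: "B \<in> T" "B \<noteq> Z" using m meets_line_iff[OF ij(2) l(2) T] ij(1) l(1) by (auto simp: B_def)
  have Beq: "B = wedge i l + (if l = d i then wedge j (d j) else Z)"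
    unfolding B_def using ij by (intro bracket_wedge_chain)
  have D: "diag \<in> comps" by (simp add: comps_def)
  consider "l = d i" | "l = i" "l \<noteq> d i" | "apart i l" using ne(4,10) d_d[of l] unfolding apart_def by metis
  then show ?thesis
  proof cases
    case 1
    then have Beq: "B = wedge i (d i) + wedge j (d j)" using Beq by simp
    have "B \<in> diag" unfolding Beq by (intro add_diag wedge_diag)
    then have "T = diag" using comps_inter T D B by blast
    moreover have "v = d ` u" using l(1) 1 ij(1) by auto
    moreover have "d ` u \<noteq> u"
    proof
      assume "d ` u = u"
      then have "d i = i" "d j = j" using dual_fixed_iff[OF u] ij(1) by auto
      then have "B = Z" using Beq by (simp add: wedge_self)
      with B show False by blast
    qed
    ultimately show ?thesis by blast
  next
    case 2
    then have "B = Z" using Beq by (simp add: wedge_self)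
    with B show ?thesis by blast
  next
    case 3
    then have "l \<noteq> d i" using apart_neq by blast
    then have "B = wedge i l" using Beq wedge_carrier[of i l] by simp
    then have "T = line {i, l}" using comps_inter[OF T _ B(1) _ B(2)] wedge_line[of i l] 3
      by (auto simp: comps_def)
    moreover have "brel u v {i, l}" unfolding ij(1) l(1) using ij 3 by (intro brelI)
    ultimately show ?thesis using 3 by auto
  qed
qed

text \<open>A pair that is not self-dual has a moved member j, and the diagonal bracket has entry 1
  at \<open>(j, j)\<close>.\<close>

lemma meets_dual:
  assumes u: "u \<in> pairs" and ne: "d ` u \<noteq> u"
  shows "meets (line u) (line (d ` u)) diag"
proof -
  obtain j where j: "j \<in> u" "d j \<noteq> j" using dual_fixed_iff[OF u] ne by blast
  obtain i where i: "u = {j, i}" "apart j i" using u j(1) by (rule pairs_memE)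
  have ij: "apart i j" "apart j (d i)" using i by (auto simp: apart_sym)
  note neq = apart_neq[OF ij(1)]
  let ?B = "lie_bracket (wedge i j) (wedge (d j) (d i))"
  have B: "?B = wedge i (d i) + wedge j (d j)"
    using bracket_wedge_chain[OF ij] by simp
  have "?B $$ (j, j) = 1"
    unfolding B using neq j(2) carrier_matD[OF wedge_carrier] by (simp add: wedge_index)
  then have "?B \<noteq> Z" using neq by auto
  moreover have "?B \<in> diag" unfolding B by (intro add_diag wedge_diag)
  moreover have "wedge i j \<in> line u" "wedge (d j) (d i) \<in> line (d ` u)"
    using wedge_line[of i j] wedge_line[of "d j" "d i"] i(1) by (simp_all add: insert_commute)
  ultimately show ?thesis unfolding meets_def by blast
qed

text \<open>\<open>diag\<close> normalizes every component, and distinct components meet in zero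
  only.\<close>

lemma meets_diag:
  assumes "V \<in> comps" "T \<in> comps" "meets diag V T" shows "T = V"
  using assms bracket_diag comps_inter unfolding meets_def by blast

text \<open>This tells lines from \<open>diag\<close>: an index l apart from both members of u
  provides a component that u carries to a different one.\<close>

lemma line_moves:
  assumes u: "u \<in> pairs"
  shows "\<exists>V\<in>\<Gamma>. \<exists>T\<in>\<Gamma>. meets (line u) V T \<and> T \<noteq> V"
proof -
  obtain i j where ij: "u = {i, j}" "apart i j" using u by (rule pairsE)
  obtain l where l: "apart i l" "apart j l" using ex_apart apart_neq(4,5)[OF ij(2)] by blast
  have "meets (line u) (line {d j, l}) (line {i, l})"
    unfolding ij(1) using ij l by (intro meets_brel brelI)
  moreover have "{i, l} \<noteq> {d j, l}"
    using apart_neq[OF ij(2)] apart_neq[OF l(1)] by (auto simp: doubleton_eq_iff)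
  then have "line {i, l} \<noteq> line {d j, l}" using line_inj[of "{i, l}" "{d j, l}"] l by auto
  ultimately show ?thesis using l unfolding Gamma_eq by (intro bexI[of _ "line {d j, l}"] bexI[of _ "line {i, l}"]) auto
qed

end

section \<open>The Weyl group\<close>

context B_algebra
begin

lemma brel_iff_meets:
  assumes "u \<in> pairs" "v \<in> pairs" "w \<in> pairs"
  shows "brel u v w \<longleftrightarrow> meets (line u) (line v) (line w)"
proof
  assume "meets (line u) (line v) (line w)"
  moreover have "line w \<in> comps" using assms by (simp add: comps_def)
  ultimately show "brel u v w"
    using meets_cases[of u v "line w"] assms line_inj line_ne_diag by metis
qed (rule meets_brel)

lemma meets_diag_iff:
  assumes "u \<in> pairs" "v \<in> pairs"
  shows "meets (line u) (line v) diag \<longleftrightarrow> v = d ` u \<and> d ` u \<noteq> u"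
proof
  assume "meets (line u) (line v) diag"
  moreover have "diag \<in> comps" by (simp add: comps_def)
  ultimately show "v = d ` u \<and> d ` u \<noteq> u"
    using meets_cases[of u v diag] assms line_ne_diag by metis
qed (use assms meets_dual in blast)

lemma Gamma_sub: "U \<in> \<Gamma> \<Longrightarrow> U \<subseteq> L"
  using Gamma_comps comps_sub by blast

lemma line_Gamma: "u \<in> pairs \<Longrightarrow> line u \<in> \<Gamma>"
  by (simp add: Gamma_eq)

lemma line_sub: "line u \<subseteq> L" and diag_sub: "diag \<subseteq> L"
  by (auto simp: line_def diag_def)

lemma lie_automorphism_zero:
  assumes "f \<in> lie_automorphisms L" shows "f Z = Z"
proof -
  have "f (0 \<cdot>\<^sub>m Z) = 0 \<cdot>\<^sub>m f Z" using assms zero_L unfolding lie_automorphisms_def by blast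
  moreover have "f Z \<in> L" using assms zero_L by (auto simp: lie_automorphisms_def dest: Bij_imp_funcset)
  then have "0 \<cdot>\<^sub>m f Z = Z" by (intro eq_matI) auto
  moreover have "0 \<cdot>\<^sub>m Z = Z" by (intro eq_matI) auto
  ultimately show ?thesis by simp
qed

text \<open>An automorphism is injective, respects the bracket and fixes zero; \<open>meets\<close>
  refers to nothing else.\<close>

lemma meets_image:
  assumes f: "f \<in> lie_automorphisms L" and UVT: "U \<subseteq> L" "V \<subseteq> L" "T \<subseteq> L"
  shows "meets (f ` U) (f ` V) (f ` T) \<longleftrightarrow> meets U V T"
proof -
  have inj: "inj_on f L" using f by (auto simp: lie_automorphisms_def Bij_def bij_betw_def)
  have eq: "f A = f B \<longleftrightarrow> A = B" if "A \<in> L" "B \<in> L" for A B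
    using inj that by (rule inj_on_eq_iff)
  have "lie_bracket (f X) (f Y) \<in> f ` T \<and> lie_bracket (f X) (f Y) \<noteq> Z \<longleftrightarrow>
      lie_bracket X Y \<in> T \<and> lie_bracket X Y \<noteq> Z" if "X \<in> U" "Y \<in> V" for X Y
  proof -
    have XY: "X \<in> L" "Y \<in> L" using that UVT by auto
    then have B: "lie_bracket X Y \<in> L" by (rule bracket_L)
    have "lie_bracket (f X) (f Y) = f (lie_bracket X Y)"
      using f XY by (simp add: lie_automorphisms_def)
    moreover have "f (lie_bracket X Y) \<in> f ` T \<longleftrightarrow> lie_bracket X Y \<in> T"
      using inj B UVT(3) by (rule inj_on_image_mem_iff)
    moreover have "f (lie_bracket X Y) = Z \<longleftrightarrow> lie_bracket X Y = Z"
      using eq[OF B zero_L] lie_automorphism_zero[OF f] by simp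
    ultimately show ?thesis by simp
  qed
  then show ?thesis by (simp add: meets_def)
qed

text \<open>If \<open>diag\<close> were sent to a line, then pulling back the two components from
  \<open>line_moves\<close> would contradict \<open>meets_diag\<close>.\<close>

lemma image_diag:
  assumes f: "f \<in> grading_aut L \<Gamma>" shows "f ` diag = diag"
proof (cases "s = 0")
  case True
  then show ?thesis using diag_trivial lie_automorphism_zero f by (simp add: grading_aut_def)
next
  case False
  have f1: "f \<in> lie_automorphisms L" and f2: "bij_betw (\<lambda>U. f ` U) \<Gamma> \<Gamma>"
    using f by (simp_all add: grading_aut_def)
  have "diag \<in> \<Gamma>" using False by (simp add: Gamma_eq)
  then have "f ` diag \<in> \<Gamma>" using f2 by (auto dest: bij_betwE)
  moreover have False if u: "u \<in> pairs" "f ` diag = line u" for u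
  proof -
    obtain V T where VT: "V \<in> \<Gamma>" "T \<in> \<Gamma>" "meets (line u) V T" "T \<noteq> V" using line_moves[OF u(1)] by blast
    have "V \<in> (\<lambda>U. f ` U) ` \<Gamma>" "T \<in> (\<lambda>U. f ` U) ` \<Gamma>"
      using VT(1,2) bij_betw_imp_surj_on[OF f2] by simp_all
    then obtain V' T' where VT': "V' \<in> \<Gamma>" "T' \<in> \<Gamma>" "V = f ` V'" "T = f ` T'" by (elim imageE)
    have "meets diag V' T'"
      using VT(3) meets_image[OF f1 diag_sub Gamma_sub Gamma_sub] VT' u(2) by simp
    then have "T' = V'" using VT'(1,2) Gamma_comps by (intro meets_diag) auto
    then show False using VT VT' by simp
  qed
  ultimately show ?thesis using False by (auto simp: Gamma_eq)
qed

text \<open>The induced map on pairs fits \<open>pairs_aut\<close>: \<open>brel\<close> is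
  \<open>meets\<close> among lines, and duality of pairs is seen from brackets that meet
  \<open>diag\<close>.\<close>

lemma grading_aut_permutation:
  assumes f: "f \<in> grading_aut L \<Gamma>"
  shows "\<exists>\<pi>\<in>centralizer. \<forall>u\<in>pairs. f ` line u = line (\<pi> ` u)"
proof -
  have f1: "f \<in> lie_automorphisms L" and f2: "bij_betw (\<lambda>U. f ` U) \<Gamma> \<Gamma>"
    using f by (simp_all add: grading_aut_def)
  have inj: "inj_on f L" using f1 by (auto simp: lie_automorphisms_def Bij_def bij_betw_def)
  note fd = image_diag[OF f]
  have "\<exists>v\<in>pairs. f ` line u = line v" if u: "u \<in> pairs" for u
  proof -
    have "f ` line u \<in> \<Gamma>" using f2 line_Gamma[OF u] by (auto dest: bij_betwE)
    moreover have "f ` line u \<noteq> diag"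
      using fd inj_on_image_eq_iff[OF inj line_sub diag_sub] line_ne_diag[OF u] by metis
    ultimately show ?thesis by (auto simp: Gamma_eq split: if_splits)
  qed
  then obtain F where F: "\<And>u. u \<in> pairs \<Longrightarrow> F u \<in> pairs" "\<And>u. u \<in> pairs \<Longrightarrow> f ` line u = line (F u)"
    by metis
  have "inj_on F pairs"
  proof (rule inj_onI)
    fix u v assume uv: "u \<in> pairs" "v \<in> pairs" "F u = F v"
    then have "f ` line u = f ` line v" using F(2) by simp
    then have "line u = line v" using inj_on_image_eq_iff[OF inj line_sub line_sub] by simp
    then show "u = v" using line_inj uv(1,2) by simp
  qed
  moreover have "F ` pairs \<subseteq> pairs" using F(1) by blast
  ultimately have bij: "bij_betw F pairs pairs" using finite_pairs by (simp add: bij_betw_def endo_inj_surj)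
  have diag_iff: "F v = d ` F u \<and> d ` F u \<noteq> F u \<longleftrightarrow> v = d ` u \<and> d ` u \<noteq> u" if "u \<in> pairs" "v \<in> pairs" for u v
    using meets_image[OF f1 line_sub line_sub diag_sub, of u v] F fd that
      meets_diag_iff[OF that] meets_diag_iff[of "F u" "F v"] by simp
  interpret pairs_aut n d F
  proof
    show "bij_betw F pairs pairs" by (rule bij)
    show "brel u v w \<longleftrightarrow> brel (F u) (F v) (F w)" if "u \<in> pairs" "v \<in> pairs" "w \<in> pairs" for u v w
      using meets_image[OF f1 line_sub line_sub line_sub, of u v w] F that
      by (simp add: brel_iff_meets)
    show "F (d ` u) = d ` F u" if u: "u \<in> pairs" for u
    proof (cases "d ` u = u")
      case False
      then show ?thesis using diag_iff[OF u dual_pairs[OF u]] by simp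
    next
      case True
      \<comment> \<open>For self-dual u no line has a diagonal bracket with that of u. Were
        \<open>F u\<close> not self-dual, v would be the label of such a line.\<close>
      obtain v where v: "v \<in> pairs" "d ` F u = F v"
        using bij_betw_imp_surj_on[OF bij] dual_pairs[OF F(1)[OF u]] by (metis imageE)
      then have "d ` F u = F u" using diag_iff[OF u v(1)] True by metis
      with True show ?thesis by simp
    qed
  qed
  show ?thesis using ex_centralizer F(2) by metis
qed

section \<open>Index permutations as automorphisms of the graded algebra\<close>

definition act :: "(nat \<Rightarrow> nat) \<Rightarrow> 'a mat \<Rightarrow> 'a mat" where
  "act \<pi> = (\<lambda>X\<in>L. mat n n (\<lambda>(k, l). X $$ (inv' \<pi> k, inv' \<pi> l)))"

lemma act_index: "X \<in> L \<Longrightarrow> k < n \<Longrightarrow> l < n \<Longrightarrow>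
    act \<pi> X $$ (k, l) = X $$ (inv' \<pi> k, inv' \<pi> l)"
  by (simp add: act_def)

lemma act_carrier: "X \<in> L \<Longrightarrow> act \<pi> X \<in> carrier_mat n n"
  by (simp add: act_def)

lemma act_eqI:
  assumes "X \<in> L" "A \<in> carrier_mat n n"
    "\<And>k l. k < n \<Longrightarrow> l < n \<Longrightarrow> X $$ (inv' \<pi> k, inv' \<pi> l) = A $$ (k, l)"
  shows "act \<pi> X = A"
  using assms carrier_matD[OF act_carrier[OF assms(1), of \<pi>]] by (intro eq_matI) (auto simp: act_index)

lemma act_L:
  assumes \<pi>: "\<pi> \<in> centralizer" and X: "X \<in> L" shows "act \<pi> X \<in> L"
proof -
  note \<rho> = centralizer_inv[OF \<pi>]
  have "act \<pi> X $$ (i, j) = - act \<pi> X $$ (d j, d i)" if "i < n" "j < n" for i j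
    using that by (simp add: act_index[OF X] centralizer_dual[OF \<rho>] L_skew[OF X] centralizer_less[OF \<rho>])
  then show ?thesis unfolding L_iff[of "act \<pi> X"] using act_carrier[OF X] by blast
qed

text \<open>\<open>act \<pi>\<close> is conjugation by a permutation matrix; the inverse in its
  definition makes it multiplicative instead of order-reversing.\<close>

lemma act_comp:
  assumes \<pi>: "\<pi> \<in> centralizer" and \<rho>: "\<rho> \<in> centralizer"
  shows "act (\<pi> \<circ> \<rho>) = compose L (act \<pi>) (act \<rho>)"
proof (rule extensionalityI[of _ L])
  fix X assume X: "X \<in> L"
  have inv: "inv' (\<pi> \<circ> \<rho>) = inv' \<rho> \<circ> inv' \<pi>"
    using permutes_bij[OF centralizer_permutes[OF \<pi>]] permutes_bij[OF centralizer_permutes[OF \<rho>]]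
    by (rule o_inv_distrib)
  have "act (\<pi> \<circ> \<rho>) X = act \<pi> (act \<rho> X)"
    using X act_carrier centralizer_less[OF centralizer_inv[OF \<pi>]]
    by (intro act_eqI) (auto simp: act_index inv act_L[OF \<rho>])
  then show "act (\<pi> \<circ> \<rho>) X = compose L (act \<pi>) (act \<rho>) X" using X by (simp add: compose_eq)
qed (simp_all add: act_def)

lemma act_id: "act id = (\<lambda>X\<in>L. X)"
proof (rule extensionalityI[of _ L])
  fix X assume X: "X \<in> L"
  have "act id X = X" using X L_carrier by (intro act_eqI) auto
  then show "act id X = (\<lambda>X\<in>L. X) X" using X by simp
qed (simp_all add: act_def)

lemma act_inverse:
  assumes \<pi>: "\<pi> \<in> centralizer" and X: "X \<in> L"
  shows "act \<pi> (act (inv' \<pi>) X) = X" "act (inv' \<pi>) (act \<pi> X) = X"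
proof -
  note p = centralizer_permutes[OF \<pi>]
  have "compose L (act \<pi>) (act (inv' \<pi>)) X = X" "compose L (act (inv' \<pi>)) (act \<pi>) X = X"
    unfolding act_comp[OF \<pi> centralizer_inv[OF \<pi>], symmetric] act_comp[OF centralizer_inv[OF \<pi>] \<pi>, symmetric]
      permutes_inv_o[OF p] act_id using X by simp_all
  then show "act \<pi> (act (inv' \<pi>) X) = X" "act (inv' \<pi>) (act \<pi> X) = X"
    using X by (simp_all add: compose_eq)
qed

lemma act_Bij: assumes \<pi>: "\<pi> \<in> centralizer" shows "act \<pi> \<in> Bij L"
proof -
  have "bij_betw (act \<pi>) L L"
    by (rule bij_betwI[of _ _ _ "act (inv' \<pi>)"])
      (use \<pi> in \<open>auto simp: act_inverse intro: act_L centralizer_inv\<close>)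
  then show ?thesis by (simp add: Bij_def act_def)
qed

lemma act_mult:
  assumes \<pi>: "\<pi> \<in> centralizer" and X: "X \<in> L" and Y: "Y \<in> L" and kl: "k < n" "l < n"
  shows "(act \<pi> X * act \<pi> Y) $$ (k, l) = (X * Y) $$ (inv' \<pi> k, inv' \<pi> l)"
proof -
  let ?\<rho> = "inv' \<pi>"
  have \<rho>: "?\<rho> \<in> centralizer" by (rule centralizer_inv[OF \<pi>])
  have bij: "bij_betw ?\<rho> {0..<n} {0..<n}"
    using permutes_imp_bij[OF centralizer_permutes[OF \<rho>]] by (simp add: atLeast0LessThan)
  have "(act \<pi> X * act \<pi> Y) $$ (k, l) = (\<Sum>t\<in>{0..<n}. act \<pi> X $$ (k, t) * act \<pi> Y $$ (t, l))"
    using act_carrier X Y kl by (intro mult_index) auto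
  also have "\<dots> = (\<Sum>t\<in>{0..<n}. X $$ (?\<rho> k, ?\<rho> t) * Y $$ (?\<rho> t, ?\<rho> l))"
    using X Y kl by (intro sum.cong) (simp_all add: act_index)
  also have "\<dots> = (\<Sum>t\<in>{0..<n}. X $$ (?\<rho> k, t) * Y $$ (t, ?\<rho> l))"
    by (rule sum.reindex_bij_betw[OF bij])
  also have "\<dots> = (X * Y) $$ (?\<rho> k, ?\<rho> l)"
    using X Y L_carrier centralizer_less[OF \<rho>] kl by (intro mult_index[symmetric]) auto
  finally show ?thesis .
qed

lemma act_lie_automorphism:
  assumes \<pi>: "\<pi> \<in> centralizer" shows "act \<pi> \<in> lie_automorphisms L"
proof -
  note less = centralizer_less[OF centralizer_inv[OF \<pi>]]
  have "act \<pi> (X + Y) = act \<pi> X + act \<pi> Y" if "X \<in> L" "Y \<in> L" for X Y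
    using that less act_carrier[of X \<pi>] act_carrier[of Y \<pi>]
    by (intro act_eqI) (auto simp: act_index intro: add_L)
  moreover have "act \<pi> (c \<cdot>\<^sub>m X) = c \<cdot>\<^sub>m act \<pi> X" if "X \<in> L" for c X
    using that less act_carrier[of X \<pi>]
    by (intro act_eqI) (auto simp: act_index intro: smult_L)
  moreover have "act \<pi> (lie_bracket X Y) = lie_bracket (act \<pi> X) (act \<pi> Y)" if "X \<in> L" "Y \<in> L" for X Y
    using that less act_carrier[of X \<pi>] act_carrier[of Y \<pi>] L_carrier
    by (intro act_eqI) (auto simp: act_mult[OF \<pi>] bracket_index bracket_carrier bracket_L simp del: index_mult_mat)
  ultimately show ?thesis using act_Bij[OF \<pi>] by (simp add: lie_automorphisms_def)
qed

text \<open>Since \<open>inv' \<pi>\<close> commutes with \<open>d\<close>, the label of a position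
  in the support is carried along by \<pi>.\<close>

lemma act_line_sub:
  assumes \<pi>: "\<pi> \<in> centralizer" shows "act \<pi> ` line u \<subseteq> line (\<pi> ` u)"
proof clarify
  fix X assume X: "X \<in> line u"
  then have XL: "X \<in> L" using line_def by auto
  let ?\<rho> = "inv' \<pi>"
  have \<rho>: "?\<rho> \<in> centralizer" by (rule centralizer_inv[OF \<pi>])
  have "{k, d l} = \<pi> ` u" if "k < n" "l < n" "act \<pi> X $$ (k, l) \<noteq> 0" for k l
  proof -
    have "{?\<rho> k, d (?\<rho> l)} = u"
      using that by (intro lineD[OF X]) (simp_all add: act_index[OF XL] centralizer_less[OF \<rho>])
    then have "\<pi> ` u = {\<pi> (?\<rho> k), \<pi> (?\<rho> (d l))}"
      using centralizer_dual[OF \<rho>] that by auto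
    then show ?thesis using centralizer_inverse[OF \<pi>] by simp
  qed
  then show "act \<pi> X \<in> line (\<pi> ` u)" using act_L[OF \<pi> XL] by (simp add: line_def)
qed

lemma act_diag_sub:
  assumes \<pi>: "\<pi> \<in> centralizer" shows "act \<pi> ` diag \<subseteq> diag"
proof clarify
  fix X assume X: "X \<in> diag"
  then have XL: "X \<in> L" using diag_def by auto
  let ?\<rho> = "inv' \<pi>"
  have \<rho>: "?\<rho> \<in> centralizer" by (rule centralizer_inv[OF \<pi>])
  have "k = l" if "k < n" "l < n" "act \<pi> X $$ (k, l) \<noteq> 0" for k l
  proof -
    have "?\<rho> k = ?\<rho> l"
      using that by (intro diagD[OF X]) (simp_all add: act_index[OF XL] centralizer_less[OF \<rho>])
    then show ?thesis using centralizer_inverse(1)[OF \<pi>] by metis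
  qed
  then show "act \<pi> X \<in> diag" using act_L[OF \<pi> XL] by (simp add: diag_def)
qed

lemma act_image:
  assumes \<pi>: "\<pi> \<in> centralizer" and "act \<pi> ` U \<subseteq> V" "act (inv' \<pi>) ` V \<subseteq> U" "V \<subseteq> L"
  shows "act \<pi> ` U = V"
proof (rule equalityI[OF assms(2)])
  show "V \<subseteq> act \<pi> ` U"
  proof
    fix X assume "X \<in> V"
    then have "X = act \<pi> (act (inv' \<pi>) X)" "act (inv' \<pi>) X \<in> U"
      using assms act_inverse(1)[OF \<pi>] by auto
    then show "X \<in> act \<pi> ` U" by blast
  qed
qed

lemma act_line: assumes \<pi>: "\<pi> \<in> centralizer" shows "act \<pi> ` line u = line (\<pi> ` u)"
proof (rule act_image[OF \<pi> act_line_sub[OF \<pi>]])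
  have "inv' \<pi> ` \<pi> ` u = u" using centralizer_inverse(2)[OF \<pi>] by (simp add: image_image)
  then show "act (inv' \<pi>) ` line (\<pi> ` u) \<subseteq> line u"
    using act_line_sub[OF centralizer_inv[OF \<pi>], of "\<pi> ` u"] by simp
  show "line (\<pi> ` u) \<subseteq> L" by (auto simp: line_def)
qed

lemma act_diag: assumes \<pi>: "\<pi> \<in> centralizer" shows "act \<pi> ` diag = diag"
  using act_image[OF \<pi> act_diag_sub[OF \<pi>] act_diag_sub[OF centralizer_inv[OF \<pi>]]] by (auto simp: diag_def)

lemma act_grading_aut:
  assumes \<pi>: "\<pi> \<in> centralizer" shows "act \<pi> \<in> grading_aut L \<Gamma>"
proof -
  have maps: "act \<rho> ` U \<in> \<Gamma>" if "\<rho> \<in> centralizer" "U \<in> \<Gamma>" for \<rho> U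
  proof -
    from that(2) consider u where "u \<in> pairs" "U = line u" | "s \<noteq> 0" "U = diag"
      by (auto simp: Gamma_eq split: if_splits)
    then show ?thesis
    proof cases
      case 1
      then show ?thesis using centralizer_pairs[OF that(1)] by (simp add: act_line[OF that(1)] Gamma_eq)
    next
      case 2
      then show ?thesis by (simp only: act_diag[OF that(1)]) (simp add: Gamma_eq)
    qed
  qed
  have inv: "act \<pi> ` act (inv' \<pi>) ` U = U" "act (inv' \<pi>) ` act \<pi> ` U = U"
    if "U \<in> \<Gamma>" for U
  proof -
    have "U \<subseteq> L" using that Gamma_comps comps_sub by blast
    note UL = subsetD[OF this]
    show "act \<pi> ` act (inv' \<pi>) ` U = U" "act (inv' \<pi>) ` act \<pi> ` U = U"
      by (simp_all add: image_image UL act_inverse[OF \<pi>] cong: image_cong_simp)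
  qed
  have "bij_betw (\<lambda>U. act \<pi> ` U) \<Gamma> \<Gamma>"
    by (rule bij_betwI[of _ _ _ "\<lambda>U. act (inv' \<pi>) ` U"])
      (use maps[OF \<pi>] maps[OF centralizer_inv[OF \<pi>]] inv in auto)
  then show ?thesis using act_lie_automorphism[OF \<pi>] by (simp add: grading_aut_def)
qed

end

section \<open>The isomorphism between the model and the group of induced permutations\<close>

sublocale B_algebra \<subseteq> graded_subalgebra L \<Gamma>
  using add_L smult_L bracket_L Gamma_sub by unfold_locales auto

context B_algebra
begin

text \<open>Every grading automorphism fixes \<open>diag\<close>, so its action is decided on the
  lines.\<close>

lemma component_action_eq_iff:
  assumes f: "f \<in> grading_aut L \<Gamma>" and g: "g \<in> grading_aut L \<Gamma>"
  shows "component_action f = component_action g \<longleftrightarrow> (\<forall>u\<in>pairs. f ` line u = g ` line u)"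
proof
  assume eq: "component_action f = component_action g"
  show "\<forall>u\<in>pairs. f ` line u = g ` line u"
    using fun_cong[OF eq] line_Gamma by (metis component_action_def restrict_apply')
next
  assume eq: "\<forall>u\<in>pairs. f ` line u = g ` line u"
  have "f ` U = g ` U" if "U \<in> \<Gamma>" for U
  proof -
    from that consider u where "u \<in> pairs" "U = line u" | "U = diag"
      by (auto simp: Gamma_eq split: if_splits)
    then show ?thesis using eq image_diag[OF f] image_diag[OF g] by cases auto
  qed
  then show "component_action f = component_action g"
    unfolding component_action_def by (intro restrict_ext) auto
qed

text \<open>Injectivity comes from the faithful action of the centralizer on pairs, surjectivity
  from \<open>grading_aut_permutation\<close>.\<close>

lemma component_action_act_iso:
  "(\<lambda>x. component_action (act (index_perm x))) \<in> iso model image_group"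
proof -
  let ?h = "\<lambda>x. component_action (act (index_perm x))"
  have aut: "act (index_perm x) \<in> grading_aut L \<Gamma>" if "x \<in> carrier model" for x
    using that by (intro act_grading_aut index_perm_centralizer)
  have carrier: "carrier image_group = component_action ` grading_aut L \<Gamma>" by simp
  have mult: "?h (x \<otimes>\<^bsub>model\<^esub> y) = ?h x \<otimes>\<^bsub>image_group\<^esub> ?h y"
    if "x \<in> carrier model" "y \<in> carrier model" for x y
    using that aut[OF that(1)] aut[OF that(2)] component_action_Bij
    by (simp add: BijGroup_def index_perm_mult act_comp index_perm_centralizer component_action_compose)
  have "?h \<in> hom model image_group"
    by (rule homI, unfold carrier, use aut in blast, rule mult)
  moreover have "inj_on ?h (carrier model)"
  proof (rule inj_onI)
    fix x y assume xy: "x \<in> carrier model" "y \<in> carrier model" "?h x = ?h y"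
    note \<pi> = index_perm_centralizer[OF xy(1)] index_perm_centralizer[OF xy(2)]
    have "index_perm x ` u = index_perm y ` u" if u: "u \<in> pairs" for u
    proof -
      have "line (index_perm x ` u) = line (index_perm y ` u)"
        using xy(3) component_action_eq_iff[OF aut[OF xy(1)] aut[OF xy(2)]] u by (simp add: act_line \<pi>)
      then show ?thesis using centralizer_pairs[OF \<pi>(1) u] centralizer_pairs[OF \<pi>(2) u] line_inj by blast
    qed
    then have "index_perm x = index_perm y" by (rule centralizer_faithful[OF \<pi>])
    then show "x = y" using index_perm_inj xy(1,2) by (auto dest: inj_onD)
  qed
  moreover have "\<exists>x\<in>carrier model. component_action f = ?h x" if f: "f \<in> grading_aut L \<Gamma>" for f
  proof -
    obtain \<pi> where \<pi>: "\<pi> \<in> centralizer" "\<forall>u\<in>pairs. f ` line u = line (\<pi> ` u)"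
      using grading_aut_permutation[OF f] by blast
    obtain x where x: "x \<in> carrier model" "index_perm x = \<pi>" using index_perm_surj[OF \<pi>(1)] by blast
    have "component_action f = component_action (act \<pi>)"
      using component_action_eq_iff[OF f act_grading_aut[OF \<pi>(1)]] \<pi> act_line by simp
    with x show ?thesis by auto
  qed
  then have "?h ` carrier model = component_action ` grading_aut L \<Gamma>" using aut by blast
  ultimately show ?thesis unfolding iso_def bij_betw_def carrier by blast
qed

end

theorem theorem5p6:
  fixes n q s :: nat
  assumes "CHAR('a::alg_closed_field) \<noteq> 2"
    and "n \<ge> 5" and "odd n" and "q + 2 * s = n"
  shows "weyl_group (so_algebra q s :: 'a mat set) (Gamma_B q s)
           \<cong> sym_group q \<times>\<times> wreath_Z2_Sym s"
proof -
  have "(2::'a) \<noteq> 0"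
  proof
    assume "(2::'a) = 0"
    \<comment> \<open>The characteristic divides each natural number that vanishes in the field, so
      it would be 1 or 2; in a field it is never 1.\<close>
    then have "CHAR('a) dvd 2" using of_nat_eq_0_iff_char_dvd[where 'a = 'a, of 2] by simp
    then have "CHAR('a) = 1 \<or> CHAR('a) = 2" using two_is_prime_nat prime_nat_iff by blast
    then show False using assms(1) CHAR_not_1'[where 'a = 'a] by simp
  qed
  moreover have "0 < q" using assms(3,4) by (cases q) auto
  ultimately interpret B_algebra q s "TYPE('a)" using assms(2,4) by unfold_locales auto
  have "image_group \<cong> model" by (rule iso_sym_closed[OF component_action_act_iso model_closed])
  with weyl_group_iso show ?thesis by (rule iso_trans)
qed

end
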